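(* Let $\mathbf{H}\in\mathbb{H}^4$. The following are equivalent: (1) $\mathbf{Cov}_2(\mathbf{H})$ is orthotropic; (2) $\mathbf{H}$ is orthotropic; (3) $\mathbf{v}_5=\mathbf{v}_6=0$ and the pair $(\mathbf{d}_2,\mathbf{c}_3)$ is orthotropic. In that case the symmetry group of $\mathbf{H}$ equals the symmetry group of the triple $(\mathbf{d}_2,\mathbf{c}_3,\mathbf{c}_4)$.
   Context: $\mathbb{H}^4$ is the space of totally symmetric traceless fourth-order tensors on $\mathbb{R}^3$, with $SO(3)$-action $(g\star\mathbf{T})(x_1,\dots,x_n)=\mathbf{T}(g^{-1}x_1,\dots,g^{-1}x_n)$. $\mathbf{Cov}_2(\mathbf{H})\subset\mathrm{Sym}^2(\mathbb{R}^3)$ is the set of values at $\mathbf{H}$ of all $SO(3)$-equivariant polynomial maps $\mathbb{H}^4\to\mathrm{Sym}^2(\mathbb{R}^3)$. $(\mathbf{H}:\mathbf{H})_{ijkl}=H_{ijmn}H_{mnkl}$, $(\mathbf{H}:\mathbf{a})_{ij}=H_{ijkl}a_{kl}$, $(\operatorname{tr}_{13}\mathbf{A})_{ij}=A_{kikj}$, $\mathbf{d}_2=\operatorname{tr}_{13}(\mathbf{H}:\mathbf{H})$, $\mathbf{c}_3=\mathbf{H}:\mathbf{d}_2$, $\mathbf{c}_4=\mathbf{H}:\mathbf{c}_3$. $\mathbf{v}_5$ and $\mathbf{v}_6$ are the vectors with components $(\mathbf{v}_5)_i=\varepsilon_{ijk}(\mathbf{d}_2\mathbf{c}_3)_{jk}$,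 $(\mathbf{v}_6)_i=\varepsilon_{ijk}(\mathbf{d}_2\mathbf{c}_4)_{jk}$, where $\varepsilon$ is the Levi-Civita tensor and products of second-order tensors are matrix products. Symmetry group of a tensor: $\{g\in SO(3):g\star\mathbf{T}=\mathbf{T}\}$; of a family or subspace: intersection; symmetry class: conjugacy class. Orthotropic $=[\mathbb{D}_2]$, $\mathbb{D}_2$ the group of rotations by $\pi$ about the three coordinate axes (with identity). *)

theory Defs
  imports "HOL-Analysis.Analysis"
begin

type_synonym vec3 = "real^3"
type_synonym ten2 = "real^3^3"
type_synonym ten4 = "3 \<Rightarrow> 3 \<Rightarrow> 3 \<Rightarrow> 3 \<Rightarrow> real"

definition SO3 :: "ten2 set" where
  "SO3 = {g. orthogonal_matrix g \<and> det g = 1}"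

text \<open>Action (g*T)(x1,..,xn) = T(g^-1 x1,..,g^-1 xn), written in components
  (for g orthogonal, g^-1 = g^T).\<close>
definition act2 :: "ten2 \<Rightarrow> ten2 \<Rightarrow> ten2" where
  "act2 g a = (\<chi> i j. \<Sum>p\<in>UNIV. \<Sum>q\<in>UNIV. g$i$p * g$j$q * a$p$q)"

definition act4 :: "ten2 \<Rightarrow> ten4 \<Rightarrow> ten4" where
  "act4 g T = (\<lambda>i j k l. \<Sum>p\<in>UNIV. \<Sum>q\<in>UNIV. \<Sum>r\<in>UNIV. \<Sum>s\<in>UNIV.
      g$i$p * g$j$q * g$k$r * g$l$s * T p q r s)"

definition harm4 :: "ten4 set" where
  "harm4 = {T. (\<forall>i j k l. T i j k l = T j i k l \<and> T i j k l = T i k j l \<and> T i j k l = T i j l k)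
               \<and> (\<forall>k l. (\<Sum>i\<in>UNIV. T i i k l) = 0)}"

definition sym2set :: "ten2 set" where
  "sym2set = {a. transpose a = a}"

inductive polyfun :: "(ten4 \<Rightarrow> real) \<Rightarrow> bool" where
  pf_const: "polyfun (\<lambda>T. c)"
| pf_comp: "polyfun (\<lambda>T. T i j k l)"
| pf_add: "polyfun f \<Longrightarrow> polyfun g \<Longrightarrow> polyfun (\<lambda>T. f T + g T)"
| pf_mult: "polyfun f \<Longrightarrow> polyfun g \<Longrightarrow> polyfun (\<lambda>T. f T * g T)"

definition equiv_poly_cov2 :: "(ten4 \<Rightarrow> ten2) \<Rightarrow> bool" where
  "equiv_poly_cov2 f \<longleftrightarrow>
     (\<forall>i j. polyfun (\<lambda>T. f T $ i $ j)) \<and>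
     (\<forall>T\<in>harm4. f T \<in> sym2set) \<and>
     (\<forall>g\<in>SO3. \<forall>T\<in>harm4. f (act4 g T) = act2 g (f T))"

definition Cov2 :: "ten4 \<Rightarrow> ten2 set" where
  "Cov2 H = {f H | f. equiv_poly_cov2 f}"

definition symgrp4 :: "ten4 \<Rightarrow> ten2 set" where
  "symgrp4 T = {g\<in>SO3. act4 g T = T}"

definition symgrp2_set :: "ten2 set \<Rightarrow> ten2 set" where
  "symgrp2_set S = {g\<in>SO3. \<forall>a\<in>S. act2 g a = a}"

definition D2 :: "ten2 set" where
  "D2 = {mat 1,
         (\<chi> i j. if i = j then (if i = 1 then 1 else -1) else 0),
         (\<chi> i j. if i = j then (if i = 2 then 1 else -1) else 0),
         (\<chi> i j. if i = j then (if i = 3 then 1 else -1) else 0)}"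

definition orthotropic :: "ten2 set \<Rightarrow> bool" where
  "orthotropic G \<longleftrightarrow> (\<exists>g\<in>SO3. G = (\<lambda>h. g ** h ** transpose g) ` D2)"

definition dd :: "ten4 \<Rightarrow> ten4 \<Rightarrow> ten4" where
  "dd A B = (\<lambda>i j k l. \<Sum>m\<in>UNIV. \<Sum>n\<in>UNIV. A i j m n * B m n k l)"

definition dd2 :: "ten4 \<Rightarrow> ten2 \<Rightarrow> ten2" where
  "dd2 A a = (\<chi> i j. \<Sum>k\<in>UNIV. \<Sum>l\<in>UNIV. A i j k l * a$k$l)"

definition tr13 :: "ten4 \<Rightarrow> ten2" where
  "tr13 A = (\<chi> i j. \<Sum>k\<in>UNIV. A k i k j)"

definition d2 :: "ten4 \<Rightarrow> ten2" where "d2 H = tr13 (dd H H)"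
definition c3 :: "ten4 \<Rightarrow> ten2" where "c3 H = dd2 H (d2 H)"
definition c4 :: "ten4 \<Rightarrow> ten2" where "c4 H = dd2 H (c3 H)"

definition levi_civita :: "3 \<Rightarrow> 3 \<Rightarrow> 3 \<Rightarrow> real" where
  "levi_civita i j k =
     (if (i,j,k) \<in> {(1,2,3),(2,3,1),(3,1,2)} then 1
      else if (i,j,k) \<in> {(1,3,2),(3,2,1),(2,1,3)} then -1 else 0)"

definition axial :: "ten2 \<Rightarrow> vec3" where
  "axial a = (\<chi> i. \<Sum>j\<in>UNIV. \<Sum>k\<in>UNIV. levi_civita i j k * a$j$k)"

definition v5 :: "ten4 \<Rightarrow> vec3" where "v5 H = axial (d2 H ** c3 H)"
definition v6 :: "ten4 \<Rightarrow> vec3" where "v6 H = axial (d2 H ** c4 H)"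

end

theory Submission
  imports Defs
begin

text \<open>
  All objects are equivariant, so the orthotropic group in question may be taken to be \<^const>\<open>D2\<close>.
  Then \<open>H\<close> is invariant under \<^const>\<open>D2\<close> iff \<open>H\<^sub>i\<^sub>j\<^sub>k\<^sub>k = 0\<close> whenever \<open>i \<noteq> j\<close>.

  (1) implies (2): \<open>Cov2 H\<close> contains the identity and is closed under the Jordan product and under
  \<open>a \<mapsto> H:a\<close>. If its symmetry group is \<^const>\<open>D2\<close>, it consists of diagonal matrices and separates the
  three diagonal positions, so it contains all diagonal matrices; hence \<open>H\<close> maps diagonal matrices
  to diagonal matrices.

  (2) implies (3): \<open>H\<close> depends on \<open>a = H\<^sub>2\<^sub>2\<^sub>3\<^sub>3\<close>, \<open>b = H\<^sub>1\<^sub>1\<^sub>3\<^sub>3\<close>, \<open>c = H\<^sub>1\<^sub>1\<^sub>2\<^sub>2\<close>, which are pairwise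
  distinct since otherwise a rotation exchanging two axes fixes \<open>H\<close>; a computation then shows that
  \<open>d2\<close> and \<open>c3\<close> together separate the three axes.

  (3) implies (2): let \<open>D\<close> and \<open>C\<close> be the diagonals of \<open>d2\<close> and \<open>c3\<close>. For \<open>i \<noteq> j\<close> the vector
  \<open>(H\<^sub>i\<^sub>j\<^sub>k\<^sub>k)\<^sub>k\<close> is orthogonal to \<open>(1,1,1)\<close> and \<open>D\<close>, and to \<open>C\<close> if \<open>D\<^sub>i \<noteq> D\<^sub>j\<close>. The only hard case is that
  of three distinct \<open>D\<^sub>i\<close> with \<open>C\<close> in the span of \<open>(1,1,1)\<close> and \<open>D\<close>. There the three vectors are
  multiples \<open>u\<close>, \<open>v\<close>, \<open>w\<close> of \<open>(1,1,1) \<times> D\<close>, and if they do not all vanish, the vanishing of the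
  off-diagonal entries of \<open>d2\<close> forces the differences \<open>D\<^sub>i - D\<^sub>j\<close> to vanish.
\<close>

section \<open>Equivariance\<close>

text \<open>Contracts a single tensor slot with \<open>g\<close>. With the other slots hidden in a
  function, \<open>act2\<close> and \<open>act4\<close> become nested \<open>contr\<close>s, and
  transformation laws reduce to reordering them by \<open>contr_swap\<close>.\<close>

definition contr :: "ten2 \<Rightarrow> 3 \<Rightarrow> (3 \<Rightarrow> real) \<Rightarrow> real" where
  "contr g i X = (\<Sum>p\<in>UNIV. g$i$p * X p)"

lemma contr_swap: "contr g i (\<lambda>p. contr h j (\<lambda>q. X p q)) = contr h j (\<lambda>q. contr g i (\<lambda>p. X p q))"
  unfolding contr_def sum_distrib_left by (subst sum.swap) (simp add: mult.left_commute)

lemma contr_contr: "contr g i (\<lambda>p. contr h p X) = contr (g ** h) i X"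
  unfolding contr_def sum_distrib_left matrix_matrix_mult_def
  by (subst sum.swap) (simp add: sum_distrib_right mult.assoc)

lemma contr_mat_1: "contr (mat 1) i X = X i"
proof -
  have "contr (mat 1) i X = (\<Sum>p\<in>UNIV. if i = p then X p else 0)"
    unfolding contr_def by (rule sum.cong) (auto simp: mat_def)
  then show ?thesis by simp
qed

lemma contr_mult_right: "contr g i X * c = contr g i (\<lambda>p. X p * c)"
  by (simp add: contr_def sum_distrib_right mult.assoc)

lemma contr_mult_left: "c * contr g i X = contr g i (\<lambda>p. c * X p)"
  by (simp add: contr_def sum_distrib_left mult.left_commute)

lemma contr_sum: "(\<Sum>r\<in>A. contr g i (\<lambda>p. X p r)) = contr g i (\<lambda>p. \<Sum>r\<in>A. X p r)"
  unfolding contr_def sum_distrib_left by (rule sum.swap)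

lemma contr_orthogonal:
  assumes "orthogonal_matrix g"
  shows "(\<Sum>k\<in>UNIV. contr g k X * contr g k Y) = (\<Sum>r\<in>UNIV. X r * Y r)"
proof -
  have "(\<Sum>k\<in>UNIV. contr g k X * contr g k Y)
      = (g *v (\<chi> r. X r)) \<bullet> (g *v (\<chi> r. Y r))"
    by (simp add: contr_def matrix_vector_mult_def inner_vec_def)
  also have "\<dots> = (\<chi> r. X r) \<bullet> (\<chi> r. Y r)"
    using assms
    by (metis orthogonal_transformation_matrix orthogonal_transformation_def matrix_vector_mul_linear
        matrix_of_matrix_vector_mul)
  finally show ?thesis by (simp add: inner_vec_def)
qed

lemma contr_orthogonal2:
  assumes "orthogonal_matrix g"
  shows "(\<Sum>k\<in>UNIV. \<Sum>l\<in>UNIV. contr g k (\<lambda>r. contr g l (\<lambda>s. X r s)) * contr g k (\<lambda>r. contr g l (\<lambda>s. Y r s)))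
       = (\<Sum>r\<in>UNIV. \<Sum>s\<in>UNIV. X r s * Y r s)"
  by (subst sum.swap)
     (simp only: contr_orthogonal[OF assms] sum.swap[of "\<lambda>l r. contr g l (X r) * contr g l (Y r)"])

lemma contr_orthogonal3:
  assumes "orthogonal_matrix g"
  shows "(\<Sum>k\<in>UNIV. \<Sum>m\<in>UNIV. \<Sum>n\<in>UNIV.
            contr g k (\<lambda>q. contr g m (\<lambda>r. contr g n (\<lambda>s. X q r s))) *
            contr g k (\<lambda>q. contr g m (\<lambda>r. contr g n (\<lambda>s. Y q r s))))
       = (\<Sum>q\<in>UNIV. \<Sum>r\<in>UNIV. \<Sum>s\<in>UNIV. X q r s * Y q r s)" (is "?L = ?R")
proof -
  have "?L = (\<Sum>m\<in>UNIV. \<Sum>n\<in>UNIV. \<Sum>k\<in>UNIV.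
            contr g k (\<lambda>q. contr g m (\<lambda>r. contr g n (\<lambda>s. X q r s))) *
            contr g k (\<lambda>q. contr g m (\<lambda>r. contr g n (\<lambda>s. Y q r s))))"
    by (subst sum.swap, rule sum.cong[OF refl], rule sum.swap)
  also have "\<dots> = (\<Sum>m\<in>UNIV. \<Sum>n\<in>UNIV. \<Sum>q\<in>UNIV.
            contr g m (\<lambda>r. contr g n (\<lambda>s. X q r s)) * contr g m (\<lambda>r. contr g n (\<lambda>s. Y q r s)))"
    by (simp only: contr_orthogonal[OF assms])
  also have "\<dots> = (\<Sum>q\<in>UNIV. \<Sum>m\<in>UNIV. \<Sum>n\<in>UNIV.
            contr g m (\<lambda>r. contr g n (\<lambda>s. X q r s)) * contr g m (\<lambda>r. contr g n (\<lambda>s. Y q r s)))"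
    by (subst (2) sum.swap, rule sum.cong[OF refl], rule sum.swap)
  also have "\<dots> = ?R"
    by (simp only: contr_orthogonal2[OF assms])
  finally show ?thesis .
qed

lemma act2_contr: "act2 g a $ i $ j = contr g i (\<lambda>p. contr g j (\<lambda>q. a$p$q))"
  by (simp add: act2_def contr_def sum_distrib_left mult.assoc)

lemma act4_contr:
  "act4 g T i j k l = contr g i (\<lambda>p. contr g j (\<lambda>q. contr g k (\<lambda>r. contr g l (\<lambda>s. T p q r s))))"
  by (simp add: act4_def contr_def sum_distrib_left mult.assoc)

lemma act2_eq_matrix_mult: "act2 g a = g ** a ** transpose g"
proof -
  have "act2 g a $ i $ j = (g ** a ** transpose g) $ i $ j" for i j
    unfolding act2_contr contr_swap[of g i g j]
    by (simp add: contr_def matrix_matrix_mult_def transpose_def mult.commute)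
  then show ?thesis by (simp add: vec_eq_iff)
qed

lemma act4_mult: "act4 (g ** h) T = act4 g (act4 h T)"
  by (intro ext) (simp only: act4_contr contr_swap[of g _ h] contr_contr)

lemma act4_mat_1: "act4 (mat 1) T = T"
  by (intro ext) (simp only: act4_contr contr_mat_1)

lemma harm4_trace: "T \<in> harm4 \<Longrightarrow> (\<Sum>i\<in>UNIV. T i i k l) = 0"
  by (simp add: harm4_def)

lemma harm4_sym:
  assumes "T \<in> harm4"
  shows "T i j k l = T j i k l" "T i j k l = T i k j l" "T i j k l = T i j l k"
  using assms by (auto simp: harm4_def)

lemma SO3_orthogonal: "g \<in> SO3 \<Longrightarrow> orthogonal_matrix g"
  by (simp add: SO3_def)

lemma SO3_transpose: "g \<in> SO3 \<Longrightarrow> transpose g \<in> SO3"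
  by (simp add: SO3_def orthogonal_matrix_transpose)

lemma SO3_mult: "g \<in> SO3 \<Longrightarrow> h \<in> SO3 \<Longrightarrow> g ** h \<in> SO3"
  by (simp add: SO3_def orthogonal_matrix_mul det_mul)

lemma SO3_cancel:
  assumes "g \<in> SO3"
  shows "g ** transpose g = mat 1" "transpose g ** g = mat 1"
  using assms by (auto simp: SO3_def orthogonal_matrix_def)

lemma act4_harm4:
  assumes "orthogonal_matrix g" "T \<in> harm4"
  shows "act4 g T \<in> harm4"
proof -
  note s = harm4_sym[OF assms(2)]
  \<comment> \<open>As equalities of functions, the symmetries can be inserted below the nested
    contractions.\<close>
  have "T = (\<lambda>p q r s. T q p r s)" "T = (\<lambda>p q r s. T p r q s)" "T = (\<lambda>p q r s. T p q s r)"
    by (intro ext, rule s)+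
  note e = this[THEN arg_cong[of _ _ "\<lambda>T. act4 g T i j k l" for i j k l]]
  have 1: "act4 g T i j k l = act4 g T j i k l" for i j k l
    by (subst e(1)) (unfold act4_contr, rule contr_swap)
  have 2: "act4 g T i j k l = act4 g T i k j l" for i j k l
    by (subst e(2)) (unfold act4_contr, subst contr_swap[of g j g k], rule refl)
  have 3: "act4 g T i j k l = act4 g T i j l k" for i j k l
    by (subst e(3)) (unfold act4_contr, subst contr_swap[of g k g l], rule refl)
  have 4: "(\<Sum>i\<in>UNIV. act4 g T i i k l) = 0" for k l
  proof -
    define Z where "Z p q = contr g k (\<lambda>r. contr g l (\<lambda>s. T p q r s))" for p q
    have gg: "(\<Sum>i\<in>UNIV. g$i$p * g$i$q) = (if p = q then 1 else 0)" for p q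
      using assms(1)[unfolded orthogonal_matrix_def, THEN conjunct1]
      by (simp add: vec_eq_iff matrix_matrix_mult_def transpose_def mat_def)
    have "(\<Sum>i\<in>UNIV. act4 g T i i k l) = (\<Sum>i\<in>UNIV. \<Sum>p\<in>UNIV. \<Sum>q\<in>UNIV. (g$i$p * g$i$q) * Z p q)"
      by (simp add: act4_contr Z_def[symmetric]) (simp add: contr_def sum_distrib_left mult.assoc)
    also have "\<dots> = (\<Sum>p\<in>UNIV. \<Sum>q\<in>UNIV. (\<Sum>i\<in>UNIV. g$i$p * g$i$q) * Z p q)"
      by (subst sum.swap, rule sum.cong[OF refl], subst sum.swap) (simp add: sum_distrib_right)
    also have "\<dots> = (\<Sum>p\<in>UNIV. Z p p)"
      unfolding gg by (simp add: if_distrib[of "\<lambda>c. c * _"] cong: if_cong)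
    also have "\<dots> = contr g k (\<lambda>r. contr g l (\<lambda>s. \<Sum>p\<in>UNIV. T p p r s))"
      by (simp only: Z_def contr_sum)
    also have "\<dots> = 0"
      by (simp add: harm4_trace[OF assms(2)] contr_def)
    finally show ?thesis .
  qed
  show ?thesis
    unfolding harm4_def using 1 2 3 4 by blast
qed

section \<open>Equivariance of \<open>dd2\<close>, \<open>d2\<close>, \<open>c3\<close> and
  \<open>c4\<close>\<close>

lemma dd2_equivariant:
  assumes "orthogonal_matrix g"
  shows "dd2 (act4 g T) (act2 g a) = act2 g (dd2 T a)"
proof -
  have "dd2 (act4 g T) (act2 g a) $ i $ j = act2 g (dd2 T a) $ i $ j" for i j
  proof -
    \<comment> \<open>\<open>X\<close> has the two free slots already rotated, so the summed slots
      stand outermost and orthogonality of \<open>g\<close> removes them.\<close>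
    define X where "X r s = contr g i (\<lambda>p. contr g j (\<lambda>q. T p q r s))" for r s
    have "act4 g T i j k l = contr g k (\<lambda>r. contr g l (\<lambda>s. X r s))" for k l
      unfolding act4_contr X_def
      by (simp only: contr_swap[of g j g k] contr_swap[of g i g k] contr_swap[of g j g l] contr_swap[of g i g l])
    then have "dd2 (act4 g T) (act2 g a) $ i $ j = (\<Sum>r\<in>UNIV. \<Sum>s\<in>UNIV. X r s * a$r$s)"
      by (simp add: dd2_def act2_contr contr_orthogonal2[OF assms])
    also have "\<dots> = act2 g (dd2 T a) $ i $ j"
      by (simp add: X_def act2_contr dd2_def contr_mult_right contr_sum)
    finally show ?thesis .
  qed
  then show ?thesis by (simp add: vec_eq_iff)
qed

text \<open>By total symmetry \<open>d2\<close> is the Gram matrix of the slices of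
  \<open>T\<close>; in this form \<open>contr_orthogonal3\<close> applies to the three summed
  indices.\<close>

lemma d2_harm4:
  assumes "T \<in> harm4"
  shows "d2 T $ i $ j = (\<Sum>k\<in>UNIV. \<Sum>m\<in>UNIV. \<Sum>n\<in>UNIV. T i k m n * T j k m n)"
proof -
  note s = harm4_sym[OF assms]
  have "T k i m n = T i k m n" "T m n k j = T j k m n" for k m n
    by (metis s)+
  then show ?thesis by (simp add: d2_def tr13_def dd_def)
qed

lemma d2_equivariant:
  assumes g: "orthogonal_matrix g" and T: "T \<in> harm4"
  shows "d2 (act4 g T) = act2 g (d2 T)"
proof -
  have "d2 (act4 g T) $ i $ j = act2 g (d2 T) $ i $ j" for i j
  proof -
    define X where "X i q r s = contr g i (\<lambda>p. T p q r s)" for i q r s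
    have "act4 g T i k m n = contr g k (\<lambda>q. contr g m (\<lambda>r. contr g n (\<lambda>s. X i q r s)))" for i k m n
      unfolding act4_contr X_def
      by (simp only: contr_swap[of g i g k] contr_swap[of g i g m] contr_swap[of g i g n])
    then have "d2 (act4 g T) $ i $ j = (\<Sum>q\<in>UNIV. \<Sum>r\<in>UNIV. \<Sum>s\<in>UNIV. X i q r s * X j q r s)"
      by (simp add: d2_harm4[OF act4_harm4[OF g T]] contr_orthogonal3[OF g])
    also have "\<dots> = (\<Sum>q\<in>UNIV. \<Sum>r\<in>UNIV. \<Sum>s\<in>UNIV.
        contr g i (\<lambda>p. contr g j (\<lambda>p'. T p q r s * T p' q r s)))"
      by (simp only: X_def contr_mult_right contr_mult_left contr_swap[of g i g j])
    also have "\<dots> = act2 g (d2 T) $ i $ j"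
      by (simp only: act2_contr d2_harm4[OF T] contr_sum)
    finally show ?thesis .
  qed
  then show ?thesis by (simp add: vec_eq_iff)
qed

lemma sym2set_nth: "a \<in> sym2set \<Longrightarrow> a $ j $ i = a $ i $ j"
  by (simp add: sym2set_def transpose_def vec_eq_iff)

lemma c3_equivariant:
  "orthogonal_matrix g \<Longrightarrow> T \<in> harm4 \<Longrightarrow> c3 (act4 g T) = act2 g (c3 T)"
  by (simp add: c3_def d2_equivariant dd2_equivariant)

lemma c4_equivariant:
  "orthogonal_matrix g \<Longrightarrow> T \<in> harm4 \<Longrightarrow> c4 (act4 g T) = act2 g (c4 T)"
  by (simp add: c4_def c3_equivariant dd2_equivariant)

lemma d2_sym: "T \<in> harm4 \<Longrightarrow> d2 T \<in> sym2set"
  by (simp add: sym2set_def vec_eq_iff transpose_def d2_harm4 mult.commute)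

lemma dd2_sym:
  assumes "T \<in> harm4"
  shows "dd2 T a \<in> sym2set"
proof -
  have "dd2 T a $ j $ i = dd2 T a $ i $ j" for i j
    using harm4_sym(1)[OF assms, of i j] by (simp add: dd2_def)
  then show ?thesis by (simp add: sym2set_def vec_eq_iff transpose_def)
qed

lemma c4_sym: "T \<in> harm4 \<Longrightarrow> c4 T \<in> sym2set"
  by (simp add: c4_def dd2_sym)

section \<open>Polynomial equivariant maps with symmetric values\<close>

lemma polyfun_sum:
  assumes "finite A" "\<And>x. x \<in> A \<Longrightarrow> polyfun (f x)"
  shows "polyfun (\<lambda>T. \<Sum>x\<in>A. f x T)"
  using assms by (induction A) (auto intro: polyfun.intros)

lemma act2_add: "act2 g (a + b) = act2 g a + act2 g b"
  by (simp add: vec_eq_iff act2_def algebra_simps sum.distrib)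

lemma act2_scaleR: "act2 g (c *\<^sub>R a) = c *\<^sub>R act2 g a"
  by (simp add: vec_eq_iff act2_def algebra_simps sum_distrib_left)

lemma act2_matrix_mult:
  assumes "g \<in> SO3"
  shows "act2 g (a ** b) = act2 g a ** act2 g b"
  using SO3_cancel[OF assms]
  by (simp add: act2_eq_matrix_mult matrix_mul_assoc[symmetric])
     (simp add: matrix_mul_assoc)

lemma act2_mat_1: "act2 (mat 1) a = a"
  by (simp add: act2_eq_matrix_mult)

lemma act2_mult: "act2 (g ** h) a = act2 g (act2 h a)"
  by (simp add: act2_eq_matrix_mult matrix_mul_assoc matrix_transpose_mul)

lemma equiv_poly_cov2_one: "equiv_poly_cov2 (\<lambda>T. mat 1)"
  by (auto simp: equiv_poly_cov2_def sym2set_def act2_eq_matrix_mult SO3_cancel intro: polyfun.intros)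

lemma equiv_poly_cov2_add:
  assumes "equiv_poly_cov2 f" "equiv_poly_cov2 h"
  shows "equiv_poly_cov2 (\<lambda>T. f T + h T)"
  using assms
  by (auto simp: equiv_poly_cov2_def sym2set_def act2_add transpose_def vec_eq_iff intro: polyfun.intros)

lemma equiv_poly_cov2_scaleR:
  assumes "equiv_poly_cov2 f"
  shows "equiv_poly_cov2 (\<lambda>T. c *\<^sub>R f T)"
  using assms
  by (auto simp: equiv_poly_cov2_def sym2set_def act2_scaleR transpose_def vec_eq_iff intro: polyfun.intros)

text \<open>A product of symmetric matrices need not be symmetric; symmetrizing it keeps the values
  in \<open>sym2set\<close>.\<close>

lemma equiv_poly_cov2_jordan:
  assumes "equiv_poly_cov2 f" "equiv_poly_cov2 h"
  shows "equiv_poly_cov2 (\<lambda>T. f T ** h T + h T ** f T)"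
proof -
  have "polyfun (\<lambda>T. (f T ** h T + h T ** f T) $ i $ j)" for i j
    using assms
    by (auto simp: equiv_poly_cov2_def matrix_matrix_mult_def intro!: polyfun.intros polyfun_sum)
  moreover have "transpose (a ** b + b ** a) = a ** b + b ** a"
    if "transpose a = a" "transpose b = b" for a b :: ten2
  proof -
    have "transpose (a ** b + b ** a) = transpose (a ** b) + transpose (b ** a)"
      by (simp add: transpose_def vec_eq_iff)
    then show ?thesis using that by (simp add: matrix_transpose_mul)
  qed
  ultimately show ?thesis
    using assms unfolding equiv_poly_cov2_def sym2set_def
    by (auto simp: act2_add act2_matrix_mult)
qed

lemma equiv_poly_cov2_dd2:
  assumes "equiv_poly_cov2 f"
  shows "equiv_poly_cov2 (\<lambda>T. dd2 T (f T))"
proof -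
  have "polyfun (\<lambda>T. dd2 T (f T) $ i $ j)" for i j
    using assms by (auto simp: equiv_poly_cov2_def dd2_def intro!: polyfun.intros polyfun_sum)
  then show ?thesis
    using assms unfolding equiv_poly_cov2_def
    by (auto simp: dd2_sym dd2_equivariant SO3_orthogonal)
qed

lemma equiv_poly_cov2_d2: "equiv_poly_cov2 d2"
proof -
  have "polyfun (\<lambda>T. d2 T $ i $ j)" for i j
    by (auto simp: d2_def tr13_def dd_def intro!: polyfun.intros polyfun_sum)
  then show ?thesis
    by (auto simp: equiv_poly_cov2_def d2_sym d2_equivariant SO3_orthogonal)
qed

section \<open>Members and closure properties of \<open>Cov2\<close>\<close>

lemma d2_c3_c4_in_Cov2: "d2 H \<in> Cov2 H" "c3 H \<in> Cov2 H" "c4 H \<in> Cov2 H"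
proof -
  have "equiv_poly_cov2 c3"
    using equiv_poly_cov2_dd2[OF equiv_poly_cov2_d2] by (simp add: c3_def[abs_def])
  moreover from this have "equiv_poly_cov2 c4"
    using equiv_poly_cov2_dd2 by (simp add: c4_def[abs_def])
  ultimately show "d2 H \<in> Cov2 H" "c3 H \<in> Cov2 H" "c4 H \<in> Cov2 H"
    using equiv_poly_cov2_d2 by (auto simp: Cov2_def)
qed

lemma Cov2_one: "mat 1 \<in> Cov2 H"
  using equiv_poly_cov2_one by (auto simp: Cov2_def)

lemma Cov2_add: "a \<in> Cov2 H \<Longrightarrow> b \<in> Cov2 H \<Longrightarrow> a + b \<in> Cov2 H"
  unfolding Cov2_def by (fast intro: equiv_poly_cov2_add)

lemma Cov2_scaleR: "a \<in> Cov2 H \<Longrightarrow> c *\<^sub>R a \<in> Cov2 H"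
  unfolding Cov2_def by (fast intro: equiv_poly_cov2_scaleR)

lemma Cov2_jordan: "a \<in> Cov2 H \<Longrightarrow> b \<in> Cov2 H \<Longrightarrow> a ** b + b ** a \<in> Cov2 H"
  unfolding Cov2_def by (fast intro: equiv_poly_cov2_jordan)

lemma Cov2_dd2: "a \<in> Cov2 H \<Longrightarrow> dd2 H a \<in> Cov2 H"
  unfolding Cov2_def by (fast intro: equiv_poly_cov2_dd2)

lemma Cov2_act4:
  assumes "g \<in> SO3" "H \<in> harm4"
  shows "Cov2 (act4 g H) = act2 g ` Cov2 H"
proof -
  have "f (act4 g H) = act2 g (f H)" if "equiv_poly_cov2 f" for f
    using that assms by (simp add: equiv_poly_cov2_def)
  then show ?thesis
    unfolding Cov2_def by auto
qed

lemma symgrp4_subset_Cov2: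
  assumes "H \<in> harm4"
  shows "symgrp4 H \<subseteq> symgrp2_set (Cov2 H)"
proof -
  have "act2 g (f H) = f H" if "g \<in> SO3" "act4 g H = H" "equiv_poly_cov2 f" for g f
    using that assms by (metis equiv_poly_cov2_def)
  then show ?thesis by (auto simp: symgrp4_def symgrp2_set_def Cov2_def)
qed

lemma symgrp2_set_antimono: "S \<subseteq> S' \<Longrightarrow> symgrp2_set S' \<subseteq> symgrp2_set S"
  by (auto simp: symgrp2_set_def)

section \<open>Change of frame\<close>

definition conj_by :: "ten2 \<Rightarrow> ten2 \<Rightarrow> ten2" where
  "conj_by g h = g ** h ** transpose g"

lemma conj_by_SO3: "g \<in> SO3 \<Longrightarrow> h \<in> SO3 \<Longrightarrow> conj_by g h \<in> SO3"
  by (simp add: conj_by_def SO3_mult SO3_transpose)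

lemma conj_by_cancel:
  assumes "g \<in> SO3"
  shows "conj_by (transpose g) (conj_by g h) = h" "conj_by g (conj_by (transpose g) h) = h"
proof -
  show "conj_by (transpose g) (conj_by g h) = h"
    using SO3_cancel[OF assms]
    by (simp add: conj_by_def matrix_mul_assoc) (simp add: matrix_mul_assoc[symmetric])
  show "conj_by g (conj_by (transpose g) h) = h"
    using SO3_cancel[OF assms]
    by (simp add: conj_by_def matrix_mul_assoc) (simp add: matrix_mul_assoc[symmetric])
qed

lemma conj_by_mult_right:
  assumes "g \<in> SO3"
  shows "conj_by g h ** g = g ** h"
  using SO3_cancel[OF assms] by (simp add: conj_by_def matrix_mul_assoc[symmetric])

lemma act4_inverse:
  assumes "g \<in> SO3"
  shows "act4 (transpose g) (act4 g T) = T" "act4 g (act4 (transpose g) T) = T"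
  using SO3_cancel[OF assms] by (simp_all add: act4_mult[symmetric] act4_mat_1)

lemma act2_inverse:
  assumes "g \<in> SO3"
  shows "act2 (transpose g) (act2 g T) = T"
  using SO3_cancel[OF assms] by (simp add: act2_mult[symmetric] act2_mat_1)

text \<open>Conjugation by \<open>transpose g\<close> inverts \<open>conj_by g\<close>, so a
  membership test on \<open>SO3\<close> settles both inclusions. This serves symmetry groups of
  tensors and of families alike.\<close>

lemma image_conj_by_eqI:
  assumes g: "g \<in> SO3" and sub: "A \<subseteq> SO3" "B \<subseteq> SO3"
    and iff: "\<And>h. h \<in> SO3 \<Longrightarrow> conj_by g h \<in> B \<longleftrightarrow> h \<in> A"
  shows "B = conj_by g ` A"
proof
  show "conj_by g ` A \<subseteq> B" using sub iff by blast
  show "B \<subseteq> conj_by g ` A"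
  proof
    fix k assume k: "k \<in> B"
    have "conj_by (transpose g) k \<in> A"
      using iff[of "conj_by (transpose g) k"] k sub g
      by (auto simp: conj_by_SO3 SO3_transpose conj_by_cancel)
    then show "k \<in> conj_by g ` A"
      by (rule rev_image_eqI) (simp add: conj_by_cancel g)
  qed
qed

lemma symgrp4_act4:
  assumes "g \<in> SO3"
  shows "symgrp4 (act4 g H) = conj_by g ` symgrp4 H"
proof (rule image_conj_by_eqI[OF assms])
  fix h assume h: "h \<in> SO3"
  have "act4 (conj_by g h) (act4 g H) = act4 g (act4 h H)"
    using assms by (simp add: act4_mult[symmetric] conj_by_mult_right)
  then show "conj_by g h \<in> symgrp4 (act4 g H) \<longleftrightarrow> h \<in> symgrp4 H"
    using assms h act4_inverse(1)[OF assms] by (auto simp: symgrp4_def conj_by_SO3) (metis)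
qed (auto simp: symgrp4_def)

lemma symgrp2_set_act2:
  assumes "g \<in> SO3"
  shows "symgrp2_set (act2 g ` S) = conj_by g ` symgrp2_set S"
proof (rule image_conj_by_eqI[OF assms])
  fix h assume h: "h \<in> SO3"
  have "act2 (conj_by g h) (act2 g a) = act2 g (act2 h a)" for a
    using assms by (simp add: act2_mult[symmetric] conj_by_mult_right)
  then show "conj_by g h \<in> symgrp2_set (act2 g ` S) \<longleftrightarrow> h \<in> symgrp2_set S"
    using assms h act2_inverse[OF assms] by (auto simp: symgrp2_set_def conj_by_SO3) (metis)
qed (auto simp: symgrp2_set_def)

lemma orthotropic_conj_frame:
  assumes "orthotropic G"
  obtains g where "g \<in> SO3" "conj_by g ` G = D2"
proof -
  obtain g where g: "g \<in> SO3" "G = conj_by g ` D2"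
    using assms by (auto simp: orthotropic_def conj_by_def[abs_def])
  have "conj_by (transpose g) ` G = D2"
    unfolding g(2) image_image by (simp add: conj_by_cancel(1)[OF g(1)])
  then show ?thesis using that g(1) SO3_transpose by blast
qed

lemma conj_by_image_inj:
  assumes "g \<in> SO3" "conj_by g ` A = conj_by g ` B"
  shows "A = B"
proof -
  have "inj (conj_by g)" by (metis assms(1) conj_by_cancel(1) injI)
  then show ?thesis using assms(2) by (simp add: inj_image_eq_iff)
qed

text \<open>Up to a factor, \<open>axial m\<close> is the vector dual to the antisymmetric part of
  \<open>m\<close>.\<close>

lemma axial_eq_0_iff: "axial m = 0 \<longleftrightarrow> transpose m = m"
  by (auto simp: axial_def levi_civita_def vec_eq_iff transpose_def forall_3 sum_3)

text \<open>Vanishing means that a matrix product is symmetric, and conjugation by a rotation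
  preserves symmetry.\<close>

lemma v5_v6_act4:
  assumes "g \<in> SO3" "H \<in> harm4"
  shows "v5 (act4 g H) = 0 \<longleftrightarrow> v5 H = 0" "v6 (act4 g H) = 0 \<longleftrightarrow> v6 H = 0"
proof -
  have *: "axial (act2 g m) = 0 \<longleftrightarrow> axial m = 0" for m
  proof -
    have "transpose (act2 g m) = act2 g (transpose m)"
      by (simp add: act2_eq_matrix_mult matrix_transpose_mul matrix_mul_assoc)
    then show ?thesis
      by (metis axial_eq_0_iff act2_inverse[OF assms(1)])
  qed
  show "v5 (act4 g H) = 0 \<longleftrightarrow> v5 H = 0" "v6 (act4 g H) = 0 \<longleftrightarrow> v6 H = 0"
    using * assms
    by (simp_all add: v5_def v6_def d2_equivariant c3_equivariant c4_equivariant SO3_orthogonal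
        flip: act2_matrix_mult)
qed

section \<open>Tensors in the standard frame\<close>

lemma contr_diag:
  assumes "\<And>i j. i \<noteq> j \<Longrightarrow> g$i$j = 0"
  shows "contr g i X = g$i$i * X i"
proof -
  have "contr g i X = (\<Sum>p\<in>UNIV. if p = i then g$i$i * X i else 0)"
    unfolding contr_def by (rule sum.cong) (use assms in auto)
  then show ?thesis by simp
qed

lemma dd2_diag:
  assumes "\<forall>i j. i \<noteq> j \<longrightarrow> a$i$j = 0"
  shows "dd2 H a $ i $ j = (\<Sum>k\<in>UNIV. H i j k k * a$k$k)"
proof -
  have "(\<Sum>l\<in>UNIV. H i j k l * a$k$l) = (\<Sum>l\<in>UNIV. if l = k then H i j k k * a$k$k else 0)" for k
    by (rule sum.cong) (use assms in auto)
  then show ?thesis by (simp add: dd2_def)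
qed

text \<open>For a diagonal matrix, orthogonality makes the diagonal entries signs, and determinant
  one leaves an even number of minus signs.\<close>

lemma D2_iff: "g \<in> D2 \<longleftrightarrow> g \<in> SO3 \<and> (\<forall>i j. i \<noteq> j \<longrightarrow> g$i$j = 0)"
proof
  show "g \<in> D2 \<Longrightarrow> g \<in> SO3 \<and> (\<forall>i j. i \<noteq> j \<longrightarrow> g$i$j = 0)"
    by (auto simp: D2_def SO3_def orthogonal_matrix_def vec_eq_iff forall_3 sum_3 det_3
        matrix_matrix_mult_def transpose_def mat_def)
  assume g: "g \<in> SO3 \<and> (\<forall>i j. i \<noteq> j \<longrightarrow> g$i$j = 0)"
  then have off: "g$1$2 = 0" "g$2$1 = 0" "g$1$3 = 0" "g$3$1 = 0" "g$2$3 = 0" "g$3$2 = 0"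
    by auto
  have "g ** transpose g = mat 1" "det g = 1" using g by (auto simp: SO3_def orthogonal_matrix_def)
  then have "g$1$1*g$1$1 = 1" "g$2$2*g$2$2 = 1" "g$3$3*g$3$3 = 1" "g$1$1*g$2$2*g$3$3 = 1"
    by (auto simp: vec_eq_iff forall_3 sum_3 det_3 matrix_matrix_mult_def transpose_def mat_def off)
  then have "(g$1$1 = 1 \<and> g$2$2 = 1 \<and> g$3$3 = 1) \<or> (g$1$1 = 1 \<and> g$2$2 = -1 \<and> g$3$3 = -1)
      \<or> (g$1$1 = -1 \<and> g$2$2 = 1 \<and> g$3$3 = -1) \<or> (g$1$1 = -1 \<and> g$2$2 = -1 \<and> g$3$3 = 1)"
    by (auto simp: square_eq_1_iff)
  then show "g \<in> D2"
    by (auto simp: D2_def vec_eq_iff forall_3 mat_def off)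
qed

lemma D2_square:
  assumes "g \<in> D2"
  shows "g$i$i * g$i$i = 1"
  using assms exhaust_3[of i] by (auto simp: D2_def mat_def)

lemma D2_contains:
  fixes i :: 3
  shows "(\<chi> p q. if p = q then (if p = i then 1 else -1) else 0) \<in> D2"
  using exhaust_3[of i] by (auto simp: D2_def)

lemma act2_D2:
  assumes "g \<in> D2"
  shows "act2 g a $ i $ j = g$i$i * g$j$j * a$i$j"
  using assms by (simp add: act2_contr contr_diag D2_iff)

lemma act4_D2:
  assumes "g \<in> D2"
  shows "act4 g T i j k l = g$i$i * g$j$j * g$k$k * g$l$l * T i j k l"
  using assms by (simp add: act4_contr contr_diag D2_iff)

text \<open>Four indices with three possible values contain an equal pair, and total symmetry moves
  it to the last two slots.\<close>

lemma harm4_eqI: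
  assumes "T \<in> harm4" "T' \<in> harm4" and eq: "\<And>i j k. T i j k k = T' i j k k"
  shows "T = T'"
proof (intro ext)
  fix i j k l :: 3
  note s = harm4_sym[OF assms(1)] and s' = harm4_sym[OF assms(2)]
  have "i = j \<or> i = k \<or> i = l \<or> j = k \<or> j = l \<or> k = l"
    using exhaust_3[of i] exhaust_3[of j] exhaust_3[of k] exhaust_3[of l] by auto
  moreover have "T i j k k = T' i j k k" "T k k i j = T' k k i j" "T k i k j = T' k i k j"
    "T k i j k = T' k i j k" "T i k k j = T' i k k j" "T i k j k = T' i k j k" for i j k
    using eq[of i j k] by (simp_all add: s s')
  ultimately show "T i j k l = T' i j k l" by blast
qed

lemma D2_subset_symgrp4_iff:
  assumes "H \<in> harm4"
  shows "D2 \<subseteq> symgrp4 H \<longleftrightarrow> (\<forall>i j k. i \<noteq> j \<longrightarrow> H i j k k = 0)"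
proof
  assume D: "D2 \<subseteq> symgrp4 H"
  show "\<forall>i j k. i \<noteq> j \<longrightarrow> H i j k k = 0"
  proof (intro allI impI)
    fix i j k :: 3
    assume "i \<noteq> j"
    \<comment> \<open>The half-turn about axis \<open>i\<close> changes the sign at \<open>j\<close>
      but not at \<open>i\<close>, and the pair \<open>k k\<close> contributes a square; so the
      entry equals its own negative.\<close>
    let ?g = "(\<chi> p q. if p = q then (if p = i then 1 else -1) else 0) :: ten2"
    have "act4 ?g H i j k k = H i j k k"
      using D D2_contains[of i] by (auto simp: symgrp4_def)
    then show "H i j k k = 0"
      using \<open>i \<noteq> j\<close> unfolding act4_D2[OF D2_contains] by (simp split: if_splits)
  qed
next
  assume odd: "\<forall>i j k. i \<noteq> j \<longrightarrow> H i j k k = 0"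
  show "D2 \<subseteq> symgrp4 H"
  proof
    fix g assume g: "g \<in> D2"
    then have "g \<in> SO3" by (simp add: D2_iff)
    moreover have "act4 g H i j k k = H i j k k" for i j k
    proof (cases "i = j")
      case True
      have "g$i$i * g$i$i * (g$k$k * g$k$k) * H i i k k = H i i k k"
        by (simp only: D2_square[OF g] mult_1)
      then show ?thesis using True by (simp add: act4_D2[OF g] mult.assoc)
    qed (use odd in \<open>simp add: act4_D2[OF g]\<close>)
    ultimately show "g \<in> symgrp4 H"
      using harm4_eqI[OF act4_harm4[OF SO3_orthogonal assms] assms] by (simp add: symgrp4_def)
  qed
qed

text \<open>The rotation by \<open>\<pi>\<close> about \<open>e\<^sub>i - e\<^sub>j\<close>.\<close>

definition swap_rot :: "3 \<Rightarrow> 3 \<Rightarrow> ten2" where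
  "swap_rot i j = (\<chi> p q. if q = (if p = i then j else if p = j then i else p) then -1 else 0)"

lemma contr_swap_rot: "contr (swap_rot i j) p X = - X (if p = i then j else if p = j then i else p)"
proof -
  let ?t = "if p = i then j else if p = j then i else p"
  have "contr (swap_rot i j) p X = (\<Sum>q\<in>UNIV. if q = ?t then - X ?t else 0)"
    unfolding contr_def swap_rot_def by (rule sum.cong) auto
  then show ?thesis by simp
qed

text \<open>A transposition matrix has determinant -1; negating it in dimension three makes the
  determinant 1.\<close>

lemma swap_rot_SO3:
  assumes "i \<noteq> j"
  shows "swap_rot i j \<in> SO3"
proof -
  have "transpose (swap_rot i j) = swap_rot i j"
    by (auto simp: vec_eq_iff transpose_def swap_rot_def)
  moreover have "swap_rot i j ** swap_rot i j = mat 1"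
  proof -
    have "(swap_rot i j ** swap_rot i j) $ p $ q = contr (swap_rot i j) p (\<lambda>k. swap_rot i j $ k $ q)" for p q
      by (simp add: matrix_matrix_mult_def contr_def)
    then show ?thesis
      using assms by (auto simp: vec_eq_iff mat_def contr_swap_rot) (auto simp: swap_rot_def)
  qed
  moreover have "det (swap_rot i j) = 1"
    using assms exhaust_3[of i] exhaust_3[of j] by (auto simp: det_3 swap_rot_def)
  ultimately show ?thesis by (simp add: SO3_def orthogonal_matrix)
qed

lemma swap_rot_notin_D2: "i \<noteq> j \<Longrightarrow> swap_rot i j \<notin> D2"
  by (auto simp: D2_iff swap_rot_def intro!: exI[of _ i] exI[of _ j])

text \<open>Half-turns about the axes kill off-diagonal entries, and \<open>swap_rot i j\<close>
  fixes every diagonal matrix with equal entries at \<open>i\<close> and \<open>j\<close>.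
  Conversely, a \<open>g\<close> fixing \<open>S\<close> commutes with its members, and a diagonal
  member separating \<open>i\<close> and \<open>j\<close> forces \<open>g$i$j = 0\<close>.\<close>

lemma symgrp2_set_eq_D2_iff:
  "symgrp2_set S = D2 \<longleftrightarrow>
    (\<forall>a\<in>S. \<forall>i j. i \<noteq> j \<longrightarrow> a$i$j = 0) \<and> (\<forall>i j. i \<noteq> j \<longrightarrow> (\<exists>a\<in>S. a$i$i \<noteq> a$j$j))"
proof (intro iffI conjI ballI allI impI)
  assume S: "symgrp2_set S = D2"
  show diag: "a$i$j = 0" if "a \<in> S" "i \<noteq> j" for a i j
  proof -
    let ?g = "(\<chi> p q. if p = q then (if p = i then 1 else -1) else 0) :: ten2"
    have "?g \<in> symgrp2_set S" using S D2_contains by simp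
    then have "act2 ?g a $ i $ j = a $ i $ j"
      using that(1) by (simp add: symgrp2_set_def)
    then show ?thesis using that(2) unfolding act2_D2[OF D2_contains] by simp
  qed
  fix i j :: 3
  assume ij: "i \<noteq> j"
  show "\<exists>a\<in>S. a$i$i \<noteq> a$j$j"
  proof (rule ccontr)
    assume "\<not> ?thesis"
    then have eq: "a$i$i = a$j$j" if "a \<in> S" for a using that by blast
    have "act2 (swap_rot i j) a = a" if "a \<in> S" for a
      using eq[OF that] diag[OF that] ij
      by (auto simp: vec_eq_iff act2_contr contr_swap_rot)
    then have "swap_rot i j \<in> symgrp2_set S"
      using swap_rot_SO3[OF ij] by (simp add: symgrp2_set_def)
    then show False using S swap_rot_notin_D2[OF ij] by simp
  qed
next
  assume "(\<forall>a\<in>S. \<forall>i j. i \<noteq> j \<longrightarrow> a$i$j = 0) \<and> (\<forall>i j. i \<noteq> j \<longrightarrow> (\<exists>a\<in>S. a$i$i \<noteq> a$j$j))"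
  then have diag: "\<And>a i j. a \<in> S \<Longrightarrow> i \<noteq> j \<Longrightarrow> a$i$j = 0"
    and sep: "\<And>i j. i \<noteq> j \<Longrightarrow> \<exists>a\<in>S. a$i$i \<noteq> a$j$j" by auto
  show "symgrp2_set S = D2"
  proof
    show "D2 \<subseteq> symgrp2_set S"
    proof
      fix g assume g: "g \<in> D2"
      have "act2 g a $ i $ j = a $ i $ j" if "a \<in> S" for a i j
        using diag[OF that] D2_square[OF g] by (cases "i = j") (auto simp: act2_D2[OF g])
      then show "g \<in> symgrp2_set S"
        using g by (auto simp: symgrp2_set_def D2_iff vec_eq_iff)
    qed
    show "symgrp2_set S \<subseteq> D2"
    proof
      fix g assume g: "g \<in> symgrp2_set S"
      then have G: "g \<in> SO3" by (simp add: symgrp2_set_def)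
      have "g$i$j = 0" if ij: "i \<noteq> j" for i j
      proof -
        obtain a where a: "a \<in> S" "a$i$i \<noteq> a$j$j" using sep[OF ij] by blast
        have "g ** a ** transpose g = a"
          using g a(1) by (simp add: symgrp2_set_def act2_eq_matrix_mult)
        then have "g ** a = a ** g"
          by (metis G SO3_cancel(2) matrix_mul_assoc matrix_mul_rid)
        moreover have "(g ** a) $ i $ j = (\<Sum>k\<in>UNIV. if k = j then g$i$j * a$j$j else 0)"
          unfolding matrix_matrix_mult_def by (simp only: vec_lambda_beta, rule sum.cong) (use diag[OF a(1)] in auto)
        moreover have "(a ** g) $ i $ j = (\<Sum>k\<in>UNIV. if k = i then a$i$i * g$i$j else 0)"
          unfolding matrix_matrix_mult_def by (simp only: vec_lambda_beta, rule sum.cong) (use diag[OF a(1)] in auto)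
        ultimately have "g$i$j * a$j$j = a$i$i * g$i$j" by (simp only: sum.delta' sum.delta finite UNIV_I if_True)
        then show ?thesis using a(2) by simp
      qed
      then show "g \<in> D2" using G by (simp add: D2_iff)
    qed
  qed
qed

section \<open>Polynomial identities\<close>

text \<open>Here \<open>f1\<close>, \<open>f2\<close>, \<open>f3\<close> stand for the diagonal of
  \<open>d2\<close>, and the two sides of the conclusion for the first two diagonal entries of
  \<open>c3\<close>. If the sides agreed, all three \<open>f\<close> would be equal; dividing their
  differences by \<open>b - a\<close> and \<open>c - a\<close> leaves two linear relations that
  force \<open>b = c\<close>.\<close>

lemma orthotropic_params_separate:
  fixes a b c f1 f2 f3 :: real
  assumes f: "f1 = (b + c)^2 + 3 * b^2 + 3 * c^2" "f2 = (a + c)^2 + 3 * a^2 + 3 * c^2" "f3 = (a + b)^2 + 3 * a^2 + 3 * b^2"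
    and ne: "a \<noteq> b" "b \<noteq> c" "a \<noteq> c" and eq: "f1 = f2"
  shows "-(b + c) * f1 + c * f2 + b * f3 \<noteq> c * f1 - (a + c) * f2 + a * f3"
proof
  assume C: "-(b + c) * f1 + c * f2 + b * f3 = c * f1 - (a + c) * f2 + a * f3"
  have "(b - a) * (2 * a + 2 * b + c) = 0"
    using eq unfolding f by (simp add: algebra_simps power2_eq_square)
  then have c: "c = -2 * a - 2 * b" using ne by auto
  have "(b - a) * (f3 - f1) = 0" using C unfolding eq by (simp add: algebra_simps)
  then have "f3 = f1" using ne by simp
  then have "(c - a) * (2 * c + 2 * a + b) = 0"
    unfolding f by (simp add: algebra_simps power2_eq_square)
  then have "2 * c + 2 * a + b = 0" using ne by auto
  then show False using c ne by auto
qed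

text \<open>A vector orthogonal to \<open>(1,1,1)\<close> and \<open>(f1,f2,f3)\<close> is a
  multiple of their cross product, whose last component is nonzero because
  \<open>f1 \<noteq> f2\<close>.\<close>

lemma sum0_orth_eq_mult:
  fixes f1 f2 f3 r1 r2 r3 :: real
  assumes "r1 + r2 + r3 = 0" "r1 * f1 + r2 * f2 + r3 * f3 = 0" "f1 \<noteq> f2"
  obtains u where "r1 = u * (f2 - f3)" "r2 = u * (f3 - f1)" "r3 = u * (f1 - f2)"
proof
  have "r1 * (f1 - f2) = r3 * (f2 - f3)" "r2 * (f1 - f2) = r3 * (f3 - f1)"
    using assms(1,2) by algebra+
  then show "r1 = r3/(f1 - f2) * (f2 - f3)" "r2 = r3/(f1 - f2) * (f3 - f1)" "r3 = r3/(f1 - f2) * (f1 - f2)"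
    using assms(3) by (simp_all add: field_simps)
qed

text \<open>
  With \<open>a = H\<^sub>2\<^sub>2\<^sub>3\<^sub>3\<close>, \<open>b = H\<^sub>1\<^sub>1\<^sub>3\<^sub>3\<close>, \<open>c = H\<^sub>1\<^sub>1\<^sub>2\<^sub>2\<close>, \<open>p\<^sub>k = H\<^sub>2\<^sub>3\<^sub>k\<^sub>k\<close>, \<open>q\<^sub>k = H\<^sub>1\<^sub>3\<^sub>k\<^sub>k\<close>, \<open>r\<^sub>k = H\<^sub>1\<^sub>2\<^sub>k\<^sub>k\<close>, these are
  the entries \<open>(1,2)\<close> and \<open>(1,1)\<close> of \<open>d2 H\<close>; the other entries arise by permuting the axes.
\<close>

definition d2_offdiag :: "real \<Rightarrow> real \<Rightarrow> real \<Rightarrow> real \<Rightarrow> real \<Rightarrow> real \<Rightarrow> real \<Rightarrow> real \<Rightarrow> real \<Rightarrow> real \<Rightarrow> real \<Rightarrow> real \<Rightarrow> real" where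
  "d2_offdiag a b c p1 p2 p3 q1 q2 q3 r1 r2 r3 =
    - (b + c) * r1 - (a + c) * r2 + 3 * c * (r1 + r2) + 3 * r3 * (a + b) + q3 * p3 + 3 * q1 * p1 + 3 * q2 * p2 + 6 * p1 * q2"

definition d2_diagonal :: "real \<Rightarrow> real \<Rightarrow> real \<Rightarrow> real \<Rightarrow> real \<Rightarrow> real \<Rightarrow> real \<Rightarrow> real \<Rightarrow> real \<Rightarrow> real \<Rightarrow> real \<Rightarrow> real \<Rightarrow> real" where
  "d2_diagonal a b c p1 p2 p3 q1 q2 q3 r1 r2 r3 =
    (b + c)^2 + 3 * b^2 + 3 * c^2 + 3 * r1^2 + 3 * q1^2 + 6 * p1^2 + r2^2 + 3 * q2^2 + 3 * r3^2 + q3^2"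

text \<open>The arguments are those of the hard case: \<open>quadratic_interpolation\<close>
  supplies \<open>k\<close> and \<rho>, and \<open>sum0_orth_eq_mult\<close> supplies
  \<open>u\<close>, \<open>v\<close>, \<open>w\<close>. The factor \<open>x - y\<close> is nonzero
  there and can be cancelled.\<close>

lemma d2_offdiag_span:
  fixes x y z :: real
  assumes "x + y + z = 0"
  shows "d2_offdiag (k * x^2 + \<rho>) (k * y^2 + \<rho>) (k * z^2 + \<rho>)
      (u * (y - z)) (u * (z - x)) (u * (x - y)) (v * (y - z)) (v * (z - x)) (v * (x - y)) (w * (y - z)) (w * (z - x)) (w * (x - y))
    = (x - y) * (4 * u * v * (x - y) - (4 * k * z^2 - (7 * k * (x^2 + y^2 + z^2)/2 + 5 * \<rho>)) * w)"
proof -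
  have z: "z = -x - y" using assms by linarith
  show ?thesis unfolding z d2_offdiag_def by (simp add: field_simps power2_eq_square)
qed

lemma d2_diagonal_diff_12:
  fixes x y z :: real
  assumes "x + y + z = 0"
  shows "d2_diagonal (k * x^2 + \<rho>) (k * y^2 + \<rho>) (k * z^2 + \<rho>)
      (u * (y - z)) (u * (z - x)) (u * (x - y)) (v * (y - z)) (v * (z - x)) (v * (x - y)) (w * (y - z)) (w * (z - x)) (w * (x - y))
    - d2_diagonal (k * y^2 + \<rho>) (k * x^2 + \<rho>) (k * z^2 + \<rho>)
      (v * (z - x)) (v * (y - z)) (v * (x - y)) (u * (z - x)) (u * (y - z)) (u * (x - y)) (w * (z - x)) (w * (y - z)) (w * (x - y))
    = (x - y) * (2 * k * z * (2 * k * (x^2 + y^2 + z^2) + 6 * \<rho> - (k * z^2 + \<rho>))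
        + 6 * z * w^2 + (2 * y + 10 * z) * u^2 + (2 * x + 10 * z) * v^2)"
proof -
  have z: "z = -x - y" using assms by linarith
  show ?thesis unfolding z d2_diagonal_def by (simp add: algebra_simps power2_eq_square)
qed

lemma d2_diagonal_diff_13:
  fixes x y z :: real
  assumes "x + y + z = 0"
  shows "d2_diagonal (k * x^2 + \<rho>) (k * y^2 + \<rho>) (k * z^2 + \<rho>)
      (u * (y - z)) (u * (z - x)) (u * (x - y)) (v * (y - z)) (v * (z - x)) (v * (x - y)) (w * (y - z)) (w * (z - x)) (w * (x - y))
    - d2_diagonal (k * z^2 + \<rho>) (k * y^2 + \<rho>) (k * x^2 + \<rho>)
      (w * (x - y)) (w * (z - x)) (w * (y - z)) (v * (x - y)) (v * (z - x)) (v * (y - z)) (u * (x - y)) (u * (z - x)) (u * (y - z))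
    = (x - z) * (2 * k * y * (2 * k * (x^2 + y^2 + z^2) + 6 * \<rho> - (k * y^2 + \<rho>))
        + 6 * y * v^2 + (2 * z + 10 * y) * u^2 + (2 * x + 10 * y) * w^2)"
proof -
  have z: "z = -x - y" using assms by linarith
  show ?thesis unfolding z d2_diagonal_def by (simp add: algebra_simps power2_eq_square)
qed

text \<open>
  In the next two lemmas \<open>x\<close>, \<open>y\<close>, \<open>z\<close> are the diagonal entries of \<open>d2\<close> minus their mean, so that the
  divided differences computed above must all be equal to \<open>1\<close>.
\<close>

lemma divided_differences_one_nonzero:
  fixes x y z :: real
  assumes s: "x + y + z = 0" and "x \<noteq> y"
    and e3: "4 * k * z^2 = 7 * k * (x^2 + y^2 + z^2)/2 + 5 * \<rho>"
    and B: "2 * k * y * (2 * k * (x^2 + y^2 + z^2) + 6 * \<rho> - (k * y^2 + \<rho>)) + (2 * x + 10 * y) * q = 1"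
    and C: "2 * k * x * (2 * k * (x^2 + y^2 + z^2) + 6 * \<rho> - (k * x^2 + \<rho>)) + (2 * y + 10 * x) * q = 1"
  shows False
proof -
  have z: "z = -x - y" using s by linarith
  \<comment> \<open>Once \<rho> and \<open>z\<close> are eliminated, \<open>B\<close> and
    \<open>C\<close> share the factor \<open>2 * k^2 * x * y + 2 * q\<close>, with cofactors
    differing by \<open>4 * (x - y)\<close>. Subtracting makes the shared factor vanish, although
    its multiples equal 1.\<close>
  have \<rho>: "\<rho> = (4 * k * z^2 - 7 * k * (x^2 + y^2 + z^2)/2)/5" using e3 by (simp add: field_simps)
  have "2 * k * y * (2 * k * (x^2 + y^2 + z^2) + 6 * \<rho> - (k * y^2 + \<rho>)) = (x + 5 * y) * (2 * k^2 * x * y)"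
    unfolding \<rho> z by (simp add: field_simps power2_eq_square)
  then have B': "(x + 5 * y) * (2 * k^2 * x * y + 2 * q) = 1" using B by (simp add: algebra_simps)
  have "2 * k * x * (2 * k * (x^2 + y^2 + z^2) + 6 * \<rho> - (k * x^2 + \<rho>)) = (y + 5 * x) * (2 * k^2 * x * y)"
    unfolding \<rho> z by (simp add: field_simps power2_eq_square)
  then have C': "(y + 5 * x) * (2 * k^2 * x * y + 2 * q) = 1" using C by (simp add: algebra_simps)
  have "(x - y) * (2 * k^2 * x * y + 2 * q) = 0" using B' C' by (simp add: algebra_simps)
  then show False using \<open>x \<noteq> y\<close> B' by simp
qed

lemma divided_differences_all_nonzero:
  fixes x y z k \<rho> u v w :: real
  defines "m \<equiv> 7 * k * (x^2 + y^2 + z^2)/2 + 5 * \<rho>"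
  assumes s: "x + y + z = 0" and "x \<noteq> y" "y \<noteq> z" "z \<noteq> x" and nz: "u \<noteq> 0" "v \<noteq> 0" "w \<noteq> 0"
    and E: "4 * u * v * (x - y) = (4 * k * z^2 - m) * w" "4 * v * w * (y - z) = (4 * k * x^2 - m) * u" "4 * u * w * (z - x) = (4 * k * y^2 - m) * v"
  shows "2 * k * z * (2 * k * (x^2 + y^2 + z^2) + 6 * \<rho> - (k * z^2 + \<rho>)) + 6 * z * w^2 + (2 * y + 10 * z) * u^2 + (2 * x + 10 * z) * v^2 = 0"
    (is "?A = 0")
proof -
  define e1 e2 e3 where "e1 = 4 * k * x^2 - m" and "e2 = 4 * k * y^2 - m" and "e3 = 4 * k * z^2 - m"
  note E' = E[folded e1_def e2_def e3_def]
  have sq: "16 * w^2 * ((y - z) * (z - x)) = e1 * e2" "16 * u^2 * ((z - x) * (x - y)) = e2 * e3" "16 * v^2 * ((x - y) * (y - z)) = e1 * e3"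
  proof -
    \<comment> \<open>Multiplying two of the three relations and cancelling a common product of two
      unknowns isolates the square of the third.\<close>
    have "(16 * w^2 * ((y - z) * (z - x))) * (u * v) = e1 * e2 * (u * v)"
      using arg_cong2[OF E'(2,3), of "(*)"] by (simp add: algebra_simps power2_eq_square)
    then show "16 * w^2 * ((y - z) * (z - x)) = e1 * e2" using nz by simp
    have "(16 * u^2 * ((z - x) * (x - y))) * (v * w) = e2 * e3 * (v * w)"
      using arg_cong2[OF E'(1,3), of "(*)"] by (simp add: algebra_simps power2_eq_square)
    then show "16 * u^2 * ((z - x) * (x - y)) = e2 * e3" using nz by simp
    have "(16 * v^2 * ((x - y) * (y - z))) * (u * w) = e1 * e3 * (u * w)"
      using arg_cong2[OF E'(1,2), of "(*)"] by (simp add: algebra_simps power2_eq_square)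
    then show "16 * v^2 * ((x - y) * (y - z)) = e1 * e3" using nz by simp
  qed
  define W where "W = (x - y) * (y - z) * (z - x)"
  have z: "z = -x - y" using s by linarith
  \<comment> \<open>Multiplication by \<open>16 * W\<close> turns every square into a left-hand side
    of \<open>sq\<close>; after the substitution only an identity in \<open>x\<close>,
    \<open>y\<close>, \<open>k\<close> and \<rho> remains.\<close>
  have "16 * W * ?A = 32 * W * k * z * (2 * k * (x^2 + y^2 + z^2) + 6 * \<rho> - (k * z^2 + \<rho>))
      + 6 * z * (x - y) * (16 * w^2 * ((y - z) * (z - x))) + (2 * y + 10 * z) * (y - z) * (16 * u^2 * ((z - x) * (x - y)))
      + (2 * x + 10 * z) * (z - x) * (16 * v^2 * ((x - y) * (y - z)))"
    unfolding W_def by (simp only: algebra_simps)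
  also have "\<dots> = 32 * W * k * z * (2 * k * (x^2 + y^2 + z^2) + 6 * \<rho> - (k * z^2 + \<rho>))
      + 6 * z * (x - y) * (e1 * e2) + (2 * y + 10 * z) * (y - z) * (e2 * e3) + (2 * x + 10 * z) * (z - x) * (e1 * e3)"
    unfolding sq ..
  also have "\<dots> = 0"
    unfolding W_def e1_def e2_def e3_def m_def z by (simp add: field_simps power2_eq_square)
  finally show ?thesis
    using assms(3-5) by (simp add: W_def)
qed

text \<open>Orthogonality to \<open>(1,1,1)\<close> and \<open>f\<close> leaves only multiples of
  \<open>(1,-1,0)\<close>, and \<open>C1 \<noteq> C2\<close> kills those for \<open>p\<close> and
  \<open>q\<close>. For \<open>r\<close> the off-diagonal entry of \<open>d2\<close> reduces to
  \<open>(a - b) * r1\<close>, where \<open>C1 \<noteq> C2\<close> forces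
  \<open>a \<noteq> b\<close>.\<close>

lemma two_equal_imp_orthotropic:
  fixes f1 f2 f3 :: real
  assumes "f1 = f2" "f3 \<noteq> f1" "C1 \<noteq> C2"
    and C: "C1 = -(b + c) * f1 + c * f2 + b * f3" "C2 = c * f1 - (a + c) * f2 + a * f3"
    and p: "p1 + p2 + p3 = 0" "p1 * f1 + p2 * f2 + p3 * f3 = 0" "p1 * C1 + p2 * C2 + p3 * C3 = 0"
    and q: "q1 + q2 + q3 = 0" "q1 * f1 + q2 * f2 + q3 * f3 = 0" "q1 * C1 + q2 * C2 + q3 * C3 = 0"
    and r: "r1 + r2 + r3 = 0" "r1 * f1 + r2 * f2 + r3 * f3 = 0"
    and off: "d2_offdiag a b c p1 p2 p3 q1 q2 q3 r1 r2 r3 = 0"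
  shows "p1 = 0 \<and> p2 = 0 \<and> p3 = 0 \<and> q1 = 0 \<and> q2 = 0 \<and> q3 = 0 \<and> r1 = 0 \<and> r2 = 0 \<and> r3 = 0"
proof -
  have third: "t3 = 0 \<and> t2 = -t1" if "t1 + t2 + t3 = 0" "t1 * f1 + t2 * f2 + t3 * f3 = 0" for t1 t2 t3
  proof -
    have "t3 * (f3 - f1) = 0" using that assms(1) by algebra
    then show ?thesis using assms(2) that(1) by auto
  qed
  have zero: "t1 = 0 \<and> t2 = 0 \<and> t3 = 0"
    if "t1 + t2 + t3 = 0" "t1 * f1 + t2 * f2 + t3 * f3 = 0" "t1 * C1 + t2 * C2 + t3 * C3 = 0" for t1 t2 t3
  proof -
    have "t1 * (C1-C2) = 0" using third[OF that(1,2)] that(3) by (simp add: algebra_simps)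
    then show ?thesis using assms(3) third[OF that(1,2)] by auto
  qed
  note P = zero[OF p] and Q = zero[OF q] and R = third[OF r]
  have "(a - b) * r1 = 0" using off P Q R by (simp add: d2_offdiag_def algebra_simps)
  moreover have "a \<noteq> b" using C assms(1,3) by (auto simp: algebra_simps)
  ultimately show ?thesis using P Q R by simp
qed

text \<open>
  The last hypothesis is the vanishing of the determinant with columns \<open>(a,b,c)\<close>, \<open>(1,1,1)\<close> and
  \<open>(x\<^sup>2,y\<^sup>2,z\<^sup>2)\<close>, rewritten with \<open>x+y+z = 0\<close>.
\<close>

lemma quadratic_interpolation:
  fixes x y z a b c :: real
  assumes "x + y + z = 0" "x \<noteq> y" "y \<noteq> z" "z \<noteq> x"
    and "a * (y - z) * x + b * (z - x) * y + c * (x - y) * z = 0"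
  obtains k \<rho> where "a = k * x^2 + \<rho>" "b = k * y^2 + \<rho>" "c = k * z^2 + \<rho>"
proof (cases "z = 0")
  case True
  \<comment> \<open>With \<open>z = 0\<close> the squares of \<open>x\<close> and \<open>y\<close>
    coincide, so \<open>a = b\<close> is forced and \<open>k\<close> interpolates between
    \<open>x^2\<close> and 0.\<close>
  then have y: "y = -x" and x: "x \<noteq> 0" using assms by auto
  have ab: "a = b"
  proof -
    have "(b - a) * (x * x) = 0" using assms(5) unfolding True y by (simp add: algebra_simps)
    then show ?thesis using x by simp
  qed
  show ?thesis
  proof (rule that)
    show "a = (a - c)/x^2 * x^2 + c" "b = (a - c)/x^2 * y^2 + c" "c = (a - c)/x^2 * z^2 + c"
      using x by (simp_all add: True y ab)
  qed
next
  case False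
  then have xy: "(x - y) * z \<noteq> 0" using assms by simp
  have z: "z = -x - y" using assms(1) by linarith
  \<comment> \<open>From \<open>x + y = -z\<close> one gets \<open>y^2 - x^2 = (x - y) * z\<close>,
    so \<open>k\<close> is the slope determined by \<open>a\<close> and \<open>b\<close>.\<close>
  define k where "k = (b - a)/((x - y) * z)"
  have k: "k * ((x - y) * z) = b - a" using xy by (simp add: k_def)
  show ?thesis
  proof (rule that)
    show "a = k * x^2 + (a - k * x^2)" by simp
    show "b = k * y^2 + (a - k * x^2)"
      using k unfolding z by (simp add: algebra_simps power2_eq_square)
    have "(x - y) * z * (k * z^2 + (a - k * x^2) - c) = 0"
      using k assms(5) unfolding z by algebra
    then show "c = k * z^2 + (a - k * x^2)" using xy by simp
  qed
qed

lemma distinct_imp_orthotropic: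
  fixes f1 f2 f3 :: real
  assumes ne: "f1 \<noteq> f2" "f2 \<noteq> f3" "f3 \<noteq> f1"
    and C: "C1 = -(b + c) * f1 + c * f2 + b * f3" "C2 = c * f1 - (a + c) * f2 + a * f3" "C3 = b * f1 + a * f2 - (a + b) * f3"
    and p: "p1 + p2 + p3 = 0" "p1 * f1 + p2 * f2 + p3 * f3 = 0" "p1 * C1 + p2 * C2 + p3 * C3 = 0"
    and q: "q1 + q2 + q3 = 0" "q1 * f1 + q2 * f2 + q3 * f3 = 0" "q1 * C1 + q2 * C2 + q3 * C3 = 0"
    and r: "r1 + r2 + r3 = 0" "r1 * f1 + r2 * f2 + r3 * f3 = 0" "r1 * C1 + r2 * C2 + r3 * C3 = 0"
    and off: "d2_offdiag a b c p1 p2 p3 q1 q2 q3 r1 r2 r3 = 0"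
      "d2_offdiag a c b p1 p3 p2 r1 r3 r2 q1 q3 q2 = 0"
      "d2_offdiag c b a r3 r2 r1 q3 q2 q1 p3 p2 p1 = 0"
    and D: "f1 = d2_diagonal a b c p1 p2 p3 q1 q2 q3 r1 r2 r3"
      "f2 = d2_diagonal b a c q2 q1 q3 p2 p1 p3 r2 r1 r3"
      "f3 = d2_diagonal c b a r3 r2 r1 q3 q2 q1 p3 p2 p1"
  shows "p1 = 0 \<and> p2 = 0 \<and> p3 = 0 \<and> q1 = 0 \<and> q2 = 0 \<and> q3 = 0 \<and> r1 = 0 \<and> r2 = 0 \<and> r3 = 0"
proof -
  obtain u where u: "p1 = u * (f2 - f3)" "p2 = u * (f3 - f1)" "p3 = u * (f1 - f2)"
    using sum0_orth_eq_mult[OF p(1,2) ne(1)] by blast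
  obtain v where v: "q1 = v * (f2 - f3)" "q2 = v * (f3 - f1)" "q3 = v * (f1 - f2)"
    using sum0_orth_eq_mult[OF q(1,2) ne(1)] by blast
  obtain w where w: "r1 = w * (f2 - f3)" "r2 = w * (f3 - f1)" "r3 = w * (f1 - f2)"
    using sum0_orth_eq_mult[OF r(1,2) ne(1)] by blast
  have "u = 0 \<and> v = 0 \<and> w = 0"
  \<comment> \<open>The expression is, up to sign, the determinant of \<open>(1,1,1)\<close>,
    \<open>f\<close> and \<open>C\<close>.\<close>
  proof (cases "(f2 - f3) * C1 + (f3 - f1) * C2 + (f1 - f2) * C3 = 0")
    case False
    have "t * ((f2 - f3) * C1 + (f3 - f1) * C2 + (f1 - f2) * C3) = 0 \<Longrightarrow> t = 0" for t
      using False by simp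
    moreover have "u * ((f2 - f3) * C1 + (f3 - f1) * C2 + (f1 - f2) * C3) = 0"
      using p(3) unfolding u by (simp add: algebra_simps)
    moreover have "v * ((f2 - f3) * C1 + (f3 - f1) * C2 + (f1 - f2) * C3) = 0"
      using q(3) unfolding v by (simp add: algebra_simps)
    moreover have "w * ((f2 - f3) * C1 + (f3 - f1) * C2 + (f1 - f2) * C3) = 0"
      using r(3) unfolding w by (simp add: algebra_simps)
    ultimately show ?thesis by blast
  next
    case True
    \<comment> \<open>Here \<open>C\<close> lies in the span of \<open>(1,1,1)\<close> and \<open>f\<close>.\<close>
    define \<mu> where "\<mu> = (f1 + f2 + f3)/3"
    define x y z where "x = f1 - \<mu>" and "y = f2 - \<mu>" and "z = f3 - \<mu>"
    have s: "x + y + z = 0" by (simp add: x_def y_def z_def \<mu>_def field_simps)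
    have df: "f2 - f3 = y - z" "f3 - f1 = z - x" "f1 - f2 = x - y" by (simp_all add: x_def y_def z_def)
    have d: "x \<noteq> y" "y \<noteq> z" "z \<noteq> x" using ne by (auto simp: x_def y_def z_def)
    have C': "C1 = c * (y - x) + b * (z - x)" "C2 = c * (x - y) + a * (z - y)" "C3 = b * (x - z) + a * (y - z)"
      unfolding C x_def y_def z_def by (simp_all add: algebra_simps)
    have "a * (y - z) * x + b * (z - x) * y + c * (x - y) * z = 0"
    proof -
      have z: "z = -x - y" using s by linarith
      show ?thesis using True unfolding df C' z by (simp add: algebra_simps)
    qed
    then obtain k \<rho> where abc: "a = k * x^2 + \<rho>" "b = k * y^2 + \<rho>" "c = k * z^2 + \<rho>"
      using quadratic_interpolation[OF s d] by blast
    define m where "m = 7 * k * (x^2 + y^2 + z^2)/2 + 5 * \<rho>"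
    note prm = u v w df abc
    have E3: "4 * u * v * (x - y) = (4 * k * z^2 - m) * w"
      using off(1) d d2_offdiag_span[OF s, of k \<rho> u v w] unfolding prm m_def by simp
    \<comment> \<open>Exchanging axes 2 and 3 reverses the sign of the cross product, hence the
      negated coefficients; \<open>E1\<close> exchanges axes 1 and 3 likewise.\<close>
    have E2: "4 * u * w * (z - x) = (4 * k * y^2 - m) * v"
    proof -
      have "(x - z) * (4 * u * w * (z - x) - (4 * k * y^2 - m) * v) = 0"
        using off(2) d2_offdiag_span[of x z y k \<rho> "-u" "-w" "-v"] s
        unfolding prm m_def by (simp add: field_simps)
      then show ?thesis using d by simp
    qed
    have E1: "4 * v * w * (y - z) = (4 * k * x^2 - m) * u"
    proof -
      have "(z - y) * (4 * v * w * (y - z) - (4 * k * x^2 - m) * u) = 0"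
        using off(3) d2_offdiag_span[of z y x k \<rho> "-w" "-v" "-u"] s
        unfolding prm m_def by (simp add: field_simps)
      then show ?thesis using d by simp
    qed
    have A: "2 * k * z * (2 * k * (x^2 + y^2 + z^2) + 6 * \<rho> - (k * z^2 + \<rho>)) + 6 * z * w^2 + (2 * y + 10 * z) * u^2 + (2 * x + 10 * z) * v^2 = 1" (is "?A = 1")
    proof -
      have "x - y = d2_diagonal a b c p1 p2 p3 q1 q2 q3 r1 r2 r3 - d2_diagonal b a c q2 q1 q3 p2 p1 p3 r2 r1 r3"
        using D(1,2) df(3) by simp
      also have "\<dots> = (x - y) * ?A"
        unfolding prm by (rule d2_diagonal_diff_12[OF s])
      finally show ?thesis using d by simp
    qed
    have B: "2 * k * y * (2 * k * (x^2 + y^2 + z^2) + 6 * \<rho> - (k * y^2 + \<rho>)) + 6 * y * v^2 + (2 * z + 10 * y) * u^2 + (2 * x + 10 * y) * w^2 = 1" (is "?B = 1")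
    proof -
      have "x - z = d2_diagonal a b c p1 p2 p3 q1 q2 q3 r1 r2 r3 - d2_diagonal c b a r3 r2 r1 q3 q2 q1 p3 p2 p1"
        using D(1,3) df(2) by simp
      also have "\<dots> = (x - z) * ?B"
        unfolding prm by (rule d2_diagonal_diff_13[OF s])
      finally show ?thesis using d by simp
    qed
    \<comment> \<open>The three differences of diagonal entries are linearly dependent, so this
      follows from \<open>A\<close> and \<open>B\<close>.\<close>
    have C: "2 * k * x * (2 * k * (x^2 + y^2 + z^2) + 6 * \<rho> - (k * x^2 + \<rho>)) + 6 * x * u^2 + (2 * z + 10 * x) * v^2 + (2 * y + 10 * x) * w^2 = 1" (is "?C = 1")
    proof -
      have z: "z = -x - y" using s by linarith
      have "(y - z) * ?C = (x - z) * (2 * k * y * (2 * k * (x^2 + y^2 + z^2) + 6 * \<rho> - (k * y^2 + \<rho>)) + 6 * y * v^2 + (2 * z + 10 * y) * u^2 + (2 * x + 10 * y) * w^2)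
          - (x - y) * (2 * k * z * (2 * k * (x^2 + y^2 + z^2) + 6 * \<rho> - (k * z^2 + \<rho>)) + 6 * z * w^2 + (2 * y + 10 * z) * u^2 + (2 * x + 10 * z) * v^2)"
        unfolding z by (simp add: algebra_simps power2_eq_square)
      then have "(y - z) * ?C = y - z" unfolding A B by simp
      then show ?thesis using d by simp
    qed
    show ?thesis
    proof (cases "u = 0 \<or> v = 0 \<or> w = 0")
      case False
      then show ?thesis using divided_differences_all_nonzero[OF s d, of u v w k \<rho>] E1 E2 E3 A m_def by simp
    next
      case True
      \<comment> \<open>If one unknown vanishes, the relation with it on the right kills the product
        of the other two; so at most one is nonzero.\<close>
      have *: "u * v = 0" "u * w = 0" "v * w = 0" using True E1 E2 E3 d by auto
      have "False" if "w \<noteq> 0"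
      proof -
        have 0: "u = 0" "v = 0" using that * by auto
        show ?thesis using divided_differences_one_nonzero[OF s d(1), of k \<rho> "w^2"] E3 B C that 0 m_def by simp
      qed
      moreover have "False" if "v \<noteq> 0"
      proof -
        have 0: "u = 0" "w = 0" using that * by auto
        \<comment> \<open>The axes are relabelled cyclically so that the nonzero coefficient takes
          the place of \<open>w\<close>.\<close>
        have "4 * k * y^2 = 7 * k * (z^2 + x^2 + y^2)/2 + 5 * \<rho>" using E2 that 0 by (simp add: m_def add_ac)
        then show ?thesis using divided_differences_one_nonzero[of z x y k \<rho> "v^2"] s d A C 0
          by (simp add: add_ac)
      qed
      moreover have "False" if "u \<noteq> 0"
      proof -
        have 0: "v = 0" "w = 0" using that * by auto
        have "4 * k * x^2 = 7 * k * (y^2 + z^2 + x^2)/2 + 5 * \<rho>" using E1 that 0 by (simp add: m_def add_ac)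
        then show ?thesis using divided_differences_one_nonzero[of y z x k \<rho> "u^2"] s d A B 0
          by (simp add: add_ac)
      qed
      ultimately show ?thesis by blast
    qed
  qed
  then show ?thesis using u v w by simp
qed

section \<open>The equivalences in the standard frame\<close>

context
  fixes H :: ten4
  assumes H: "H \<in> harm4"
begin

private abbreviation "a \<equiv> H 2 2 3 3"
private abbreviation "b \<equiv> H 1 1 3 3"
private abbreviation "c \<equiv> H 1 1 2 2"
private abbreviation "p k \<equiv> H 2 3 k k"
private abbreviation "q k \<equiv> H 1 3 k k"
private abbreviation "r k \<equiv> H 1 2 k k"

private lemmas sym = harm4_sym[OF H]

lemma harm4_traces:
  "H 1 1 1 1 = -(b+c)" "H 2 2 2 2 = -(a+c)" "H 3 3 3 3 = -(a+b)"
  "p 1 + p 2 + p 3 = 0" "q 1 + q 2 + q 3 = 0" "r 1 + r 2 + r 3 = 0"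
proof -
  note tr = harm4_trace[OF H, unfolded sum_3]
  show "H 1 1 1 1 = -(b+c)" using tr[of 1 1] by (simp add: sym)
  show "H 2 2 2 2 = -(a+c)" using tr[of 2 2] by (simp add: sym)
  show "H 3 3 3 3 = -(a+b)" using tr[of 3 3] by (simp add: sym)
  show "p 1 + p 2 + p 3 = 0" using tr[of 2 3] by (simp add: sym)
  show "q 1 + q 2 + q 3 = 0" using tr[of 1 3] by (simp add: sym)
  show "r 1 + r 2 + r 3 = 0" using tr[of 1 2] by (simp add: sym)
qed

lemma d2_components:
  "d2 H $ 1 $ 1 = d2_diagonal a b c (p 1) (p 2) (p 3) (q 1) (q 2) (q 3) (r 1) (r 2) (r 3)"
  "d2 H $ 2 $ 2 = d2_diagonal b a c (q 2) (q 1) (q 3) (p 2) (p 1) (p 3) (r 2) (r 1) (r 3)"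
  "d2 H $ 3 $ 3 = d2_diagonal c b a (r 3) (r 2) (r 1) (q 3) (q 2) (q 1) (p 3) (p 2) (p 1)"
  "d2 H $ 1 $ 2 = d2_offdiag a b c (p 1) (p 2) (p 3) (q 1) (q 2) (q 3) (r 1) (r 2) (r 3)"
  "d2 H $ 1 $ 3 = d2_offdiag a c b (p 1) (p 3) (p 2) (r 1) (r 3) (r 2) (q 1) (q 3) (q 2)"
  "d2 H $ 2 $ 3 = d2_offdiag c b a (r 3) (r 2) (r 1) (q 3) (q 2) (q 1) (p 3) (p 2) (p 1)"
  by (simp_all add: d2_harm4[OF H] sum_3 d2_diagonal_def d2_offdiag_def sym harm4_traces(1-3)
      algebra_simps power2_eq_square)

lemma c3_diag_components:
  assumes "\<forall>i j. i \<noteq> j \<longrightarrow> d2 H $ i $ j = 0"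
  shows "c3 H $ 1 $ 1 = -(b+c)*d2 H$1$1 + c*d2 H$2$2 + b*d2 H$3$3"
    "c3 H $ 2 $ 2 = c*d2 H$1$1 - (a+c)*d2 H$2$2 + a*d2 H$3$3"
    "c3 H $ 3 $ 3 = b*d2 H$1$1 + a*d2 H$2$2 - (a+b)*d2 H$3$3"
  unfolding c3_def dd2_diag[OF assms] sum_3 harm4_traces(1-3)
  by (simp_all add: sym algebra_simps)

lemma symgrp4_eq_D2_imp:
  assumes "symgrp4 H = D2"
  shows "symgrp2_set {d2 H, c3 H} = D2"
proof -
  have odd: "H i j k k = 0" if "i \<noteq> j" for i j k
    using D2_subset_symgrp4_iff[OF H] assms that by blast
  \<comment> \<open>Since \<open>odd\<close> disposes of the remaining entries, invariance of the
    entries \<open>H p p k k\<close> under the transposition \<open>t\<close> would make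
    \<open>swap_rot i j\<close> fix \<open>H\<close>; its four minus signs cancel.\<close>
  have swap: "\<not> (\<forall>p k. H (t p) (t p) (t k) (t k) = H p p k k)"
    if "i \<noteq> j" and t: "t = (\<lambda>p. if p = i then j else if p = j then i else p)" for i j t
  proof
    assume eq: "\<forall>p k. H (t p) (t p) (t k) (t k) = H p p k k"
    have "H (t p) (t q) (t k) (t k) = H p q k k" for p q k
    proof (cases "p = q")
      case False
      then have "t p \<noteq> t q" by (auto simp: t)
      then show ?thesis using False by (simp add: odd)
    qed (use eq in auto)
    then have "act4 (swap_rot i j) H p q k k = H p q k k" for p q k
      unfolding act4_contr contr_swap_rot t by simp
    then have "act4 (swap_rot i j) H = H"
      using harm4_eqI[OF act4_harm4[OF SO3_orthogonal[OF swap_rot_SO3] H] H] that(1) by blast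
    then have "swap_rot i j \<in> symgrp4 H"
      using swap_rot_SO3 that(1) by (simp add: symgrp4_def)
    then show False using assms swap_rot_notin_D2 that(1) by blast
  qed
  have ne: "a \<noteq> b" "b \<noteq> c" "a \<noteq> c"
    using swap[of 1 2, OF _ refl] swap[of 2 3, OF _ refl] swap[of 1 3, OF _ refl]
    by (auto simp: forall_3 harm4_traces(1-3) sym)
  have d2_diag: "\<forall>i j. i \<noteq> j \<longrightarrow> d2 H $ i $ j = 0"
  proof -
    have "d2 H $ 1 $ 2 = 0" "d2 H $ 1 $ 3 = 0" "d2 H $ 2 $ 3 = 0"
      unfolding d2_components by (simp_all add: odd d2_offdiag_def)
    moreover have "d2 H $ j $ i = d2 H $ i $ j" for i j
      by (rule sym2set_nth[OF d2_sym[OF H]])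
    ultimately show ?thesis by (auto simp: forall_3)
  qed
  have c3_diag: "c3 H $ i $ j = 0" if "i \<noteq> j" for i j
    unfolding c3_def dd2_diag[OF d2_diag] using that by (simp add: odd)
  note C = c3_diag_components[OF d2_diag]
  have D: "d2 H$1$1 = (b+c)^2 + 3*b^2 + 3*c^2" "d2 H$2$2 = (a+c)^2 + 3*a^2 + 3*c^2"
    "d2 H$3$3 = (a+b)^2 + 3*a^2 + 3*b^2"
    unfolding d2_components by (simp_all add: odd d2_diagonal_def add.commute)
  note sep = orthotropic_params_separate
  have "d2 H$1$1 \<noteq> d2 H$2$2 \<or> c3 H$1$1 \<noteq> c3 H$2$2"
    using sep[OF D] ne unfolding C by blast
  moreover have "d2 H$1$1 \<noteq> d2 H$3$3 \<or> c3 H$1$1 \<noteq> c3 H$3$3"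
  proof -
    \<comment> \<open>Exchanging axes 2 and 3 exchanges \<open>b\<close> and \<open>c\<close> and
      brings this pair into the shape of \<open>sep\<close>.\<close>
    have "d2 H$1$1 = (c+b)^2 + 3*c^2 + 3*b^2" "d2 H$3$3 = (a+b)^2 + 3*a^2 + 3*b^2"
      "d2 H$2$2 = (a+c)^2 + 3*a^2 + 3*c^2" by (simp_all add: D algebra_simps)
    from sep[OF this] show ?thesis using ne unfolding C by (auto simp: algebra_simps)
  qed
  moreover have "d2 H$2$2 \<noteq> d2 H$3$3 \<or> c3 H$2$2 \<noteq> c3 H$3$3"
  proof -
    have "d2 H$2$2 = (c+a)^2 + 3*c^2 + 3*a^2" "d2 H$3$3 = (b+a)^2 + 3*b^2 + 3*a^2"
      "d2 H$1$1 = (b+c)^2 + 3*b^2 + 3*c^2" by (simp_all add: D algebra_simps)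
    from sep[OF this] show ?thesis using ne unfolding C by (auto simp: algebra_simps)
  qed
  ultimately have sep: "d2 H$i$i \<noteq> d2 H$j$j \<or> c3 H$i$i \<noteq> c3 H$j$j" if "i \<noteq> j" for i j
    using that exhaust_3[of i] exhaust_3[of j] by metis
  show ?thesis
    unfolding symgrp2_set_eq_D2_iff using d2_diag c3_diag sep by auto
qed

lemma pair_eq_D2_imp:
  assumes "symgrp2_set {d2 H, c3 H} = D2" and v6: "v6 H = 0"
  shows "symgrp4 H = D2"
proof -
  have d2_diag: "\<forall>i j. i \<noteq> j \<longrightarrow> d2 H $ i $ j = 0" and c3_diag: "\<forall>i j. i \<noteq> j \<longrightarrow> c3 H $ i $ j = 0"
    and sep: "\<And>i j. i \<noteq> j \<Longrightarrow> d2 H$i$i \<noteq> d2 H$j$j \<or> c3 H$i$i \<noteq> c3 H$j$j"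
    using assms(1) unfolding symgrp2_set_eq_D2_iff by auto
  define D where "D k = d2 H $ k $ k" for k
  define C where "C k = c3 H $ k $ k" for k
  note C_eq = c3_diag_components[OF d2_diag, folded D_def C_def]
  have orthD: "H i j 1 1 * D 1 + H i j 2 2 * D 2 + H i j 3 3 * D 3 = 0" if "i \<noteq> j" for i j
    using that c3_diag unfolding c3_def dd2_diag[OF d2_diag] by (simp add: sum_3 D_def)
  \<comment> \<open>As \<open>d2 H\<close> is diagonal, \<open>v6 H = 0\<close> means
    \<open>(D i - D j) * c4 H $ i $ j = 0\<close>. So \<open>c4 H $ i $ j\<close>, the pairing with
    \<open>C\<close>, vanishes.\<close>
  have orthC: "H i j 1 1 * C 1 + H i j 2 2 * C 2 + H i j 3 3 * C 3 = 0" if "D i \<noteq> D j" for i j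
  proof -
    have c4: "c4 H $ j $ i = c4 H $ i $ j"
      by (rule sym2set_nth[OF c4_sym[OF H]])
    have prod: "(d2 H ** c4 H) $ i $ j = D i * c4 H $ i $ j" for i j
    proof -
      have "(d2 H ** c4 H) $ i $ j = (\<Sum>k\<in>UNIV. if k = i then D i * c4 H $ i $ j else 0)"
        unfolding matrix_matrix_mult_def D_def
        by (simp only: vec_lambda_beta, rule sum.cong) (use d2_diag in auto)
      then show ?thesis by simp
    qed
    have "d2 H ** c4 H \<in> sym2set"
      using v6 by (simp add: v6_def axial_eq_0_iff sym2set_def)
    from sym2set_nth[OF this, of j i] have "c4 H $ i $ j = 0" using that unfolding prod c4 by simp
    then show ?thesis
      unfolding c4_def dd2_diag[OF c3_diag] by (simp add: sum_3 C_def)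
  qed
  have off0: "d2 H $ 1 $ 2 = 0" "d2 H $ 1 $ 3 = 0" "d2 H $ 2 $ 3 = 0" using d2_diag by auto
  note off = off0[unfolded d2_components]
  note Deq = d2_components(1-3)[folded D_def]
  have sep': "D i = D j \<Longrightarrow> C i \<noteq> C j" if "i \<noteq> j" for i j
    using sep[OF that] by (auto simp: D_def C_def)
  \<comment> \<open>If all \<open>D\<close> were equal, tracelessness of \<open>H\<close> would give
    \<open>C 1 = C 2 = 0\<close>, against separation.\<close>
  have not_all: "\<not> (D 1 = D 2 \<and> D 2 = D 3)"
    using sep'[of 1 2] C_eq by (auto simp: algebra_simps)
  note tr = harm4_traces(4-6)
  have "p 1 = 0 \<and> p 2 = 0 \<and> p 3 = 0 \<and> q 1 = 0 \<and> q 2 = 0 \<and> q 3 = 0 \<and> r 1 = 0 \<and> r 2 = 0 \<and> r 3 = 0"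
  proof -
    consider "D 1 \<noteq> D 2" "D 2 \<noteq> D 3" "D 3 \<noteq> D 1" | "D 1 = D 2" "D 3 \<noteq> D 1"
      | "D 1 = D 3" "D 2 \<noteq> D 1" | "D 3 = D 2" "D 1 \<noteq> D 3"
      using not_all by metis
    then show ?thesis
    proof cases
      case 1
      show ?thesis
        by (rule distinct_imp_orthotropic[OF 1 C_eq tr(1) _ _ tr(2) _ _ tr(3) _ _ off Deq])
           (use 1 in \<open>auto intro!: orthD orthC\<close>)
    next
      case 2
      show ?thesis
        by (rule two_equal_imp_orthotropic[OF 2 sep'[OF _ 2(1)] C_eq(1,2) tr(1) _ _ tr(2) _ _ tr(3) _ off(1)])
           (use 2 orthD[of 2 3] orthC[of 2 3] orthD[of 1 3] orthC[of 1 3] orthD[of 1 2] in auto)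
    next
      case 3
      \<comment> \<open>Axes 2 and 3 are exchanged: \<open>b\<close> and \<open>c\<close> trade
        places, as do \<open>q\<close> and \<open>r\<close>. The last case exchanges axes 1 and 3
        instead.\<close>
      have "p 1 = 0 \<and> p 3 = 0 \<and> p 2 = 0 \<and> r 1 = 0 \<and> r 3 = 0 \<and> r 2 = 0 \<and> q 1 = 0 \<and> q 3 = 0 \<and> q 2 = 0"
        by (rule two_equal_imp_orthotropic[OF 3 sep'[OF _ 3(1)], where a = a and b = c and c = b and ?C3.0 = "C 2"])
           (use 3 C_eq tr off orthD[of 2 3] orthC[of 2 3] orthD[of 1 2] orthC[of 1 2] orthD[of 1 3]
             in \<open>auto simp: algebra_simps\<close>)
      then show ?thesis by blast
    next
      case 4
      have "r 3 = 0 \<and> r 2 = 0 \<and> r 1 = 0 \<and> q 3 = 0 \<and> q 2 = 0 \<and> q 1 = 0 \<and> p 3 = 0 \<and> p 2 = 0 \<and> p 1 = 0"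
        by (rule two_equal_imp_orthotropic[OF 4 sep'[OF _ 4(1)], where a = c and b = b and c = a and ?C3.0 = "C 1"])
           (use 4 C_eq tr off orthD[of 2 3] orthC[of 1 2] orthD[of 1 2] orthC[of 1 3] orthD[of 1 3]
             in \<open>auto simp: algebra_simps\<close>)
      then show ?thesis by blast
    qed
  qed
  then have z: "H 1 2 k k = 0 \<and> H 1 3 k k = 0 \<and> H 2 3 k k = 0" for k
    using exhaust_3[of k] by auto
  have "H i j k k = 0" if "i \<noteq> j" for i j k
    using that z[of k] sym(1)[of 2 1] sym(1)[of 3 1] sym(1)[of 3 2] exhaust_3[of i] exhaust_3[of j] by auto
  then have "D2 \<subseteq> symgrp4 H" using D2_subset_symgrp4_iff[OF H] by blast
  moreover have "symgrp4 H \<subseteq> symgrp2_set {d2 H, c3 H}"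
    using symgrp4_subset_Cov2[OF H] symgrp2_set_antimono[of "{d2 H, c3 H}" "Cov2 H"] d2_c3_c4_in_Cov2[of H]
    by blast
  ultimately show ?thesis using assms(1) by blast
qed

text \<open>For each \<open>k\<close> a member \<open>e\<close> of \<open>Cov2 H\<close> is
  supported at position \<open>k\<close> of the diagonal. As \<open>dd2 H e\<close> also lies in
  \<open>Cov2 H\<close>, it is diagonal, and its off-diagonal entries are multiples of
  \<open>H i j k k\<close>.\<close>

lemma Cov2_eq_D2_imp:
  assumes "symgrp2_set (Cov2 H) = D2"
  shows "symgrp4 H = D2"
proof -
  have diag: "\<And>a i j. a \<in> Cov2 H \<Longrightarrow> i \<noteq> j \<Longrightarrow> a $ i $ j = 0"
    and sep: "\<And>i j. i \<noteq> j \<Longrightarrow> \<exists>a\<in>Cov2 H. a $ i $ i \<noteq> a $ j $ j"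
    using assms unfolding symgrp2_set_eq_D2_iff by auto
  have "H i j k k = 0" if ij: "i \<noteq> j" for i j k
  proof -
    obtain m n :: 3 where mn: "m \<noteq> k" "n \<noteq> k" "\<And>l. l \<noteq> k \<Longrightarrow> l = m \<or> l = n"
    proof -
      have "\<exists>m n :: 3. m \<noteq> k \<and> n \<noteq> k \<and> (\<forall>l. l \<noteq> k \<longrightarrow> l = m \<or> l = n)"
        using exhaust_3[of k]
        by (elim disjE) (rule exI[of _ 2], rule exI[of _ 3], simp add: forall_3,
            rule exI[of _ 1], rule exI[of _ 3], simp add: forall_3,
            rule exI[of _ 1], rule exI[of _ 2], simp add: forall_3)
      then show ?thesis using that by blast
    qed
    obtain f where f: "f \<in> Cov2 H" "f$k$k \<noteq> f$m$m" using sep[of k m] mn(1) by blast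
    obtain h where h: "h \<in> Cov2 H" "h$k$k \<noteq> h$n$n" using sep[of k n] mn(2) by blast
    \<comment> \<open>Subtracting multiples of the identity makes \<open>f'\<close> vanish at
      \<open>m\<close> and \<open>h'\<close> at \<open>n\<close>, so their Jordan product vanishes
      at both.\<close>
    define f' where "f' = f + (- f$m$m) *\<^sub>R mat 1"
    define h' where "h' = h + (- h$n$n) *\<^sub>R mat 1"
    \<comment> \<open>Among the diagonal entries of \<open>e\<close>, only the one at position \<open>k\<close> is nonzero.\<close>
    define e where "e = f' ** h' + h' ** f'"
    have in_Cov: "f' \<in> Cov2 H" "h' \<in> Cov2 H"
      unfolding f'_def h'_def by (intro Cov2_add Cov2_scaleR Cov2_one f(1) h(1))+
    then have e: "e \<in> Cov2 H" unfolding e_def by (rule Cov2_jordan)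
    have e_diag: "e$l$l = 2 * (f$l$l - f$m$m) * (h$l$l - h$n$n)" for l
    proof -
      have prod: "(x ** y) $ l $ l = x$l$l * y$l$l" if "x \<in> Cov2 H" for x y
      proof -
        have "(x ** y) $ l $ l = (\<Sum>k\<in>UNIV. if k = l then x$l$l * y$l$l else 0)"
          unfolding matrix_matrix_mult_def
          by (simp only: vec_lambda_beta, rule sum.cong) (use diag[OF that] in auto)
        then show ?thesis by simp
      qed
      show ?thesis
        unfolding e_def by (simp add: prod in_Cov) (simp add: f'_def h'_def mat_def algebra_simps)
    qed
    have "dd2 H e $ i $ j = (\<Sum>l\<in>UNIV. H i j l l * e$l$l)"
      using diag[OF e] by (intro dd2_diag) blast
    also have "\<dots> = (\<Sum>l\<in>UNIV. if l = k then H i j k k * e$k$k else 0)"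
      by (rule sum.cong) (use mn(3) in \<open>auto simp: e_diag\<close>)
    finally have "H i j k k * e$k$k = 0"
      using diag[OF Cov2_dd2[OF e] ij] by simp
    then show ?thesis using f(2) h(2) by (simp add: e_diag)
  qed
  then have "D2 \<subseteq> symgrp4 H" using D2_subset_symgrp4_iff[OF H] by blast
  then show ?thesis using symgrp4_subset_Cov2[OF H] assms by blast
qed

end

section \<open>Transfer from the standard frame to an arbitrary one\<close>

lemma symgrp4_orthotropic_imp:
  assumes H: "H \<in> harm4" and "orthotropic (symgrp4 H)"
  shows "symgrp2_set {d2 H, c3 H} = symgrp4 H" "v5 H = 0" "v6 H = 0"
proof -
  obtain g where g: "g \<in> SO3" "conj_by g ` symgrp4 H = D2"
    using assms(2) by (rule orthotropic_conj_frame)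
  let ?K = "act4 g H"
  have K: "?K \<in> harm4" using g H by (simp add: act4_harm4 SO3_orthogonal)
  have sK: "symgrp4 ?K = D2" using g by (simp add: symgrp4_act4)
  have pair: "symgrp2_set {d2 ?K, c3 ?K} = conj_by g ` symgrp2_set {d2 H, c3 H}"
    using symgrp2_set_act2[OF g(1), of "{d2 H, c3 H}"] g H
    by (simp add: d2_equivariant c3_equivariant SO3_orthogonal)
  show "symgrp2_set {d2 H, c3 H} = symgrp4 H"
    using symgrp4_eq_D2_imp[OF K sK] pair g conj_by_image_inj by metis
  \<comment> \<open>The group of the triple lies between \<open>symgrp4 ?K\<close> and the group of
    the pair, both equal to \<open>D2\<close>; hence \<open>c4 ?K\<close> is diagonal as
    well.\<close>
  have "symgrp4 ?K \<subseteq> symgrp2_set {d2 ?K, c3 ?K, c4 ?K}"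
    using symgrp4_subset_Cov2[OF K] symgrp2_set_antimono[of "{d2 ?K, c3 ?K, c4 ?K}" "Cov2 ?K"]
      d2_c3_c4_in_Cov2[of ?K] by blast
  then have "symgrp2_set {d2 ?K, c3 ?K, c4 ?K} = D2"
    using sK symgrp4_eq_D2_imp[OF K sK]
      symgrp2_set_antimono[of "{d2 ?K, c3 ?K}" "{d2 ?K, c3 ?K, c4 ?K}"] by blast
  then have diag: "d2 ?K $ i $ j = 0" "c3 ?K $ i $ j = 0" "c4 ?K $ i $ j = 0" if "i \<noteq> j" for i j
    using that unfolding symgrp2_set_eq_D2_iff by auto
  have "v5 ?K = 0" "v6 ?K = 0"
    unfolding v5_def v6_def axial_eq_0_iff
    by (simp_all add: diag vec_eq_iff forall_3 transpose_def matrix_matrix_mult_def sum_3)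
  then show "v5 H = 0" "v6 H = 0" using v5_v6_act4[OF g(1) H] by auto
qed

theorem theorem9p11:
  fixes H :: ten4
  assumes "H \<in> harm4"
  shows "(orthotropic (symgrp2_set (Cov2 H)) \<longleftrightarrow> orthotropic (symgrp4 H))
       \<and> (orthotropic (symgrp4 H) \<longleftrightarrow>
            v5 H = 0 \<and> v6 H = 0 \<and> orthotropic (symgrp2_set {d2 H, c3 H}))
       \<and> (orthotropic (symgrp4 H) \<longrightarrow>
            symgrp4 H = symgrp2_set {d2 H, c3 H, c4 H})"
proof -
  \<comment> \<open>In the orthotropic case the last group equals the first, so the whole chain
    collapses.\<close>
  have chain: "symgrp4 H \<subseteq> symgrp2_set (Cov2 H)"
    "symgrp2_set (Cov2 H) \<subseteq> symgrp2_set {d2 H, c3 H, c4 H}"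
    "symgrp2_set {d2 H, c3 H, c4 H} \<subseteq> symgrp2_set {d2 H, c3 H}"
    using symgrp4_subset_Cov2[OF assms] d2_c3_c4_in_Cov2[of H]
    by (auto intro!: symgrp2_set_antimono)
  have from_Cov2: "orthotropic (symgrp4 H)" if ortho: "orthotropic (symgrp2_set (Cov2 H))"
  proof -
    obtain g where g: "g \<in> SO3" "conj_by g ` symgrp2_set (Cov2 H) = D2"
      using ortho by (rule orthotropic_conj_frame)
    have "symgrp2_set (Cov2 (act4 g H)) = D2"
      using g assms by (simp add: Cov2_act4 symgrp2_set_act2)
    then have "conj_by g ` symgrp4 H = D2"
      using Cov2_eq_D2_imp[OF act4_harm4[OF SO3_orthogonal[OF g(1)] assms]] g(1)
      by (simp add: symgrp4_act4)
    then show ?thesis using g ortho conj_by_image_inj by metis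
  qed
  have from_pair: "orthotropic (symgrp4 H)"
    if v6: "v6 H = 0" and ortho: "orthotropic (symgrp2_set {d2 H, c3 H})"
  proof -
    obtain g where g: "g \<in> SO3" "conj_by g ` symgrp2_set {d2 H, c3 H} = D2"
      using ortho by (rule orthotropic_conj_frame)
    have "symgrp2_set {d2 (act4 g H), c3 (act4 g H)} = D2"
      using symgrp2_set_act2[OF g(1), of "{d2 H, c3 H}"] g assms
      by (simp add: d2_equivariant c3_equivariant SO3_orthogonal)
    then have "conj_by g ` symgrp4 H = D2"
      using pair_eq_D2_imp[OF act4_harm4[OF SO3_orthogonal[OF g(1)] assms]] g(1) v6
        v5_v6_act4[OF g(1) assms] by (simp add: symgrp4_act4)
    then show ?thesis using g ortho conj_by_image_inj by metis
  qed
  have groups: "symgrp2_set (Cov2 H) = symgrp4 H" "symgrp2_set {d2 H, c3 H, c4 H} = symgrp4 H"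
    if "orthotropic (symgrp4 H)"
    using chain symgrp4_orthotropic_imp(1)[OF assms that] by simp_all
  show ?thesis
    using from_Cov2 from_pair symgrp4_orthotropic_imp[OF assms] groups by metis
qed

end
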